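(* Given a $k$-dimensional subspace $\mathcal{X}_*$ of $\mathbb{R}^n$, the maximizer $X_{\mathrm{opt}}$ of $$\max_{X\in\mathbb{O}^{n\times k},\ \mathcal{R}(X)=\mathcal{X}_*} f_\theta(X)$$ admits the decomposition $$X_{\mathrm{opt}}=X_{\mathcal{X}_*}+Y_{\mathcal{X}_*},$$ where $X_{\mathcal{X}_*}$ depends on $\mathcal{X}_*$ only and $Y_{\mathcal{X}_*}$ has a freedom of $\mathbb{O}^{(k-r)\times(k-r)}$, and $r=\mathrm{rank}_D(\mathcal{X}_* )$. Moreover $\mathrm{rank}(X_{\mathcal{X}_*})=r$ and $\mathrm{rank}(Y_{\mathcal{X}_*})=k-r$.
   Context: Standing setting: $1\le k<n$; $A,B\in\mathbb{R}^{n\times n}$ are symmetric, $B$ is positive semidefinite with $\mathrm{rank}(B)>n-k$; $D\in\mathbb{R}^{n\times k}$; $0\le\theta\le 1$ (all fixed). $\mathbb{O}^{p\times q}=\{X\in\mathbb{R}^{p\times q}: X^{T}X=I_q\}$; $\mathcal{R}(X)$ is the column space of $X$. For $X\in\mathbb{O}^{n\times k}$, $f_\theta(X)=\mathrm{trace}(X^{T}AX+X^{T}D)/[\mathrm{trace}(X^{T}BX)]^{\theta}$. For a $k$-dimensional subspace $\mathcal{X}$ of $\mathbb{R}^n$, $\mathrm{rank}_D(\mathcal{X}):=\mathrm{rank}(X^{T}D)$ for any $X\in\mathbb{O}^{n\times k}$ with $\mathcal{R}(X)=\mathcal{X}$ (this does not depend on the choice of $X$). *)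

theory Defs
  imports Complex_Main "Jordan_Normal_Form.DL_Rank"
begin

definition mat_trace :: "real mat \<Rightarrow> real" where
  "mat_trace M = (\<Sum>i<dim_row M. M $$ (i, i))"

text \<open>The library's rank and column space take the ambient dimension (the number of rows)
  as an argument.\<close>

definition mat_rank :: "real mat \<Rightarrow> nat" where
  "mat_rank M = vec_space.rank (dim_row M) M"

definition mat_range :: "real mat \<Rightarrow> real vec set" where
  "mat_range M = vec_space.col_space (dim_row M) M"

definition subspaces_of_dim :: "nat \<Rightarrow> nat \<Rightarrow> real vec set set" where
  "subspaces_of_dim n k =
     {S. VectorSpace.subspace class_ring S (module_vec TYPE(real) n) \<and>
         vectorspace.dim class_ring ((module_vec TYPE(real) n)\<lparr>carrier := S\<rparr>) = k}"

definition symmetric_matrix :: "real mat \<Rightarrow> bool" where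
  "symmetric_matrix M \<longleftrightarrow> transpose_mat M = M"

definition pos_semidef :: "real mat \<Rightarrow> bool" where
  "pos_semidef M \<longleftrightarrow> symmetric_matrix M \<and>
     (\<forall>v\<in>carrier_vec (dim_row M). 0 \<le> v \<bullet> (M *\<^sub>v v))"

text \<open>Real matrices with orthonormal columns. For \<open>q = 0\<close> this is the singleton of the
  \<open>p \<times> 0\<close> matrix.\<close>

definition orthonormal_mats :: "nat \<Rightarrow> nat \<Rightarrow> real mat set" where
  "orthonormal_mats p q = {X \<in> carrier_mat p q. transpose_mat X * X = 1\<^sub>m q}"

text \<open>If \<open>B\<close> is positive semidefinite with \<open>rank B > n - k\<close>, the trace in the denominator is
  positive for every \<open>X\<close> with orthonormal columns, so \<open>powr\<close> is the ordinary real power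
  (and equals 1 for \<open>\<theta> = 0\<close>).\<close>

definition f_theta :: "real mat \<Rightarrow> real mat \<Rightarrow> real mat \<Rightarrow> real \<Rightarrow> real mat \<Rightarrow> real" where
  "f_theta A B D \<theta> X =
     mat_trace (transpose_mat X * A * X + transpose_mat X * D) /
     mat_trace (transpose_mat X * B * X) powr \<theta>"

text \<open>The common value of \<open>rank (X\<^sup>T D)\<close> over all orthonormal bases \<open>X\<close> of \<open>S\<close>.\<close>

definition rank_D :: "nat \<Rightarrow> nat \<Rightarrow> real mat \<Rightarrow> real vec set \<Rightarrow> nat" where
  "rank_D n k D S =
     (THE r. \<forall>X\<in>orthonormal_mats n k. mat_range X = S \<longrightarrow> mat_rank (transpose_mat X * D) = r)"

definition maximizers ::
  "nat \<Rightarrow> nat \<Rightarrow> real mat \<Rightarrow> real mat \<Rightarrow> real mat \<Rightarrow> real \<Rightarrow> real vec set \<Rightarrow> real mat set" where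
  "maximizers n k A B D \<theta> S =
     {X. is_arg_max (f_theta A B D \<theta>) (\<lambda>X. X \<in> orthonormal_mats n k \<and> mat_range X = S) X}"

end

theory Submission
  imports Defs "Jordan_Normal_Form.Spectral_Radius"
begin

text \<open>
  Let \<open>X\<^sub>0\<close> be an orthonormal basis of the given subspace \<open>S\<close>. A matrix \<open>X\<close> with
  orthonormal columns has column space \<open>S\<close> exactly when it has the same orthogonal projector,
  \<open>X X\<^sup>T = X\<^sub>0 X\<^sub>0\<^sup>T\<close> (\<open>mat_range_eq_iff_projector_eq\<close>). By cyclicity of the trace,
  \<open>trace (X\<^sup>T A X)\<close> and \<open>trace (X\<^sup>T B X)\<close> depend on the projector only, so they are constant
  over the feasible set; the second one is positive because the kernel of \<open>B\<close> is too small to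
  contain \<open>S\<close> (\<open>trace_pos_semidef_pos\<close>). What remains is to maximize the linear function
  \<open>trace (X\<^sup>T D)\<close>, an orthogonal Procrustes problem.

  The matrix \<open>X\<^sub>0\<^sup>T D\<close> has rank \<open>r = rank_D n k D S\<close> and a compact singular value decomposition
  \<open>U\<^sub>1 \<Sigma> W\<^sub>1\<^sup>T\<close>, where \<open>[U\<^sub>1 U\<^sub>2]\<close> and \<open>[W\<^sub>1 W\<^sub>2]\<close> are orthogonal
  (\<open>compact_singular_value_decomposition\<close>). Put \<open>P\<^sub>i = X\<^sub>0 U\<^sub>i\<close>. The function to maximize is then the
  sum of the inner products of corresponding columns of \<open>X W\<^sub>1\<close> and \<open>P\<^sub>1\<close>, weighted by the
  positive singular values. As these columns are unit vectors, the maximum is attained exactly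
  when \<open>X W\<^sub>1 = P\<^sub>1\<close> (\<open>trace_orthonormal_le\<close>). Such an \<open>X\<close> is still free to map the span of
  \<open>W\<^sub>2\<close> isometrically onto the span of \<open>P\<^sub>2\<close>, so the maximizers are the matrices
  \<open>P\<^sub>1 W\<^sub>1\<^sup>T + P\<^sub>2 Q W\<^sub>2\<^sup>T\<close> with \<open>Q\<close> orthogonal of order \<open>k - r\<close>
  (\<open>bij_betw_orthonormal_completions\<close>). Both summands are products of a matrix with orthonormal
  columns and the transpose of another, which gives their ranks.

  The real singular value decomposition is obtained by deflation from a singular triple, which in
  turn comes from a complex eigenvector of \<open>M\<^sup>T M\<close>.
\<close>

section \<open>Matrix algebra over the reals\<close>

text \<open>With side conditions that equate dimensions, unlike membership in \<open>carrier_mat\<close>, the laws of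
  matrix algebra are conditional rewrite rules without extra variables to be guessed. This lets
  the simplifier normalise products of rectangular matrices.\<close>

lemma mult_assoc_dim:
  fixes A B C :: "real mat"
  shows "dim_col A = dim_row B \<Longrightarrow> dim_col B = dim_row C \<Longrightarrow> A * B * C = A * (B * C)"
  by (rule assoc_mult_mat[of A "dim_row A" "dim_row B" B "dim_row C" C "dim_col C"]) auto

lemma transpose_mult_dim:
  fixes A B :: "real mat"
  shows "dim_col A = dim_row B \<Longrightarrow> (A * B)\<^sup>T = B\<^sup>T * A\<^sup>T"
  by (rule transpose_mult[of A "dim_row A" "dim_row B" B "dim_col B"]) auto

lemma mult_add_distrib_dim:
  fixes A B C :: "real mat"
  shows "dim_col A = dim_row B \<Longrightarrow> dim_row B = dim_row C \<Longrightarrow> dim_col B = dim_col C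
    \<Longrightarrow> A * (B + C) = A * B + A * C"
  by (rule mult_add_distrib_mat[of A "dim_row A" "dim_row B" B "dim_col B" C]) auto

lemma add_mult_distrib_dim:
  fixes A B C :: "real mat"
  shows "dim_row A = dim_row B \<Longrightarrow> dim_col A = dim_col B \<Longrightarrow> dim_col B = dim_row C
    \<Longrightarrow> (A + B) * C = A * C + B * C"
  by (rule add_mult_distrib_mat[of A "dim_row B" "dim_row C" B C "dim_col C"]) auto

lemma mult_mat_vec_assoc_dim:
  fixes A B :: "real mat"
  shows "dim_col A = dim_row B \<Longrightarrow> dim_col B = dim_vec v \<Longrightarrow> A * B *\<^sub>v v = A *\<^sub>v (B *\<^sub>v v)"
  by (rule assoc_mult_mat_vec[of A "dim_row A" "dim_row B" B "dim_col B"]) auto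

lemma col_mult_dim:
  fixes A B :: "real mat"
  shows "dim_col A = dim_row B \<Longrightarrow> j < dim_col B \<Longrightarrow> col (A * B) j = A *\<^sub>v col B j"
  by (rule eq_vecI) auto

lemmas mat_algebra = mult_assoc_dim transpose_mult_dim mult_add_distrib_dim add_mult_distrib_dim

lemma scalar_prod_self_eq_0:
  fixes v :: "real vec"
  shows "v \<bullet> v = 0 \<longleftrightarrow> v = 0\<^sub>v (dim_vec v)"
proof
  assume "v \<bullet> v = 0"
  then have "(\<Sum>i<dim_vec v. v $ i * v $ i) = 0"
    by (simp add: scalar_prod_def lessThan_atLeast0)
  then have "\<forall>i<dim_vec v. v $ i = 0"
    by (subst (asm) sum_nonneg_eq_0_iff) auto
  then show "v = 0\<^sub>v (dim_vec v)" by (intro eq_vecI) auto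
next
  assume *: "v = 0\<^sub>v (dim_vec v)"
  show "v \<bullet> v = 0" by (subst *, subst (2) *) simp
qed

lemma scalar_prod_self_nonneg: "0 \<le> v \<bullet> v" for v :: "real vec"
  by (auto simp: scalar_prod_def intro: sum_nonneg)

lemma mat_diag_dims: "dim_row (mat_diag r s) = r" "dim_col (mat_diag r s) = r"
  by (simp_all add: mat_diag_def)

lemma mat_diag_inverse:
  fixes s :: "nat \<Rightarrow> real"
  assumes "\<forall>i<r. s i \<noteq> 0"
  shows "mat_diag r (\<lambda>i. 1 / s i) * mat_diag r s = 1\<^sub>m r"
  unfolding mat_diag_diag using assms by (intro eq_matI) (auto simp: mat_diag_def)

lemma ex_unit_multiple:
  fixes v :: "real vec"
  assumes "v \<in> carrier_vec n" and "v \<noteq> 0\<^sub>v n"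
  shows "\<exists>c. (c \<cdot>\<^sub>v v) \<bullet> (c \<cdot>\<^sub>v v) = 1"
proof -
  have "v \<bullet> v > 0"
    using assms scalar_prod_self_eq_0[of v] scalar_prod_self_nonneg[of v] by (auto simp: less_le)
  then show ?thesis
    using assms by (intro exI[of _ "1 / sqrt (v \<bullet> v)"]) (simp add: field_simps)
qed

lemma mat_trace_mult_commute:
  assumes "A \<in> carrier_mat p q" and "B \<in> carrier_mat q p"
  shows "mat_trace (A * B) = mat_trace (B * A)"
proof -
  have "mat_trace (A * B) = (\<Sum>i<p. \<Sum>j<q. A $$ (i,j) * B $$ (j,i))"
    using assms by (simp add: mat_trace_def scalar_prod_def lessThan_atLeast0)
  also have "\<dots> = (\<Sum>j<q. \<Sum>i<p. B $$ (j,i) * A $$ (i,j))"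
    by (subst sum.swap) (simp add: mult.commute)
  also have "\<dots> = mat_trace (B * A)"
    using assms by (simp add: mat_trace_def scalar_prod_def lessThan_atLeast0)
  finally show ?thesis .
qed

lemma mat_trace_add:
  assumes "A \<in> carrier_mat p p" and "B \<in> carrier_mat p p"
  shows "mat_trace (A + B) = mat_trace A + mat_trace B"
  using assms by (simp add: mat_trace_def sum.distrib)

section \<open>Rank, column space and orthonormal columns\<close>

lemma mat_range_eq_image:
  assumes "M \<in> carrier_mat m p"
  shows "mat_range M = (\<lambda>v. M *\<^sub>v v) ` carrier_vec p"
  using assms vec_space.col_space_eq[OF assms] by (auto simp: mat_range_def)

text \<open>A left inverse makes \<open>G\<close> injective, so its columns are distinct and linearly
  independent.\<close>

lemma mat_rank_left_inverse:
  fixes G :: "real mat"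
  assumes G: "G \<in> carrier_mat m r" and L: "L \<in> carrier_mat r m" and LG: "L * G = 1\<^sub>m r"
  shows "mat_rank G = r" and "r \<le> m"
proof -
  interpret vec_space "TYPE(real)" m .
  have inj: "v = 0\<^sub>v r" if v: "v \<in> carrier_vec r" and "G *\<^sub>v v = 0\<^sub>v m" for v
  proof -
    have "v = (L * G) *\<^sub>v v" using v LG by simp
    also have "\<dots> = L *\<^sub>v (G *\<^sub>v v)" by (rule assoc_mult_mat_vec[OF L G v])
    also have "\<dots> = 0\<^sub>v r" using that(2) L by (auto intro!: eq_vecI)
    finally show ?thesis .
  qed
  have dist: "distinct (cols G)"
  proof (subst distinct_conv_nth, intro allI impI)
    fix i j assume ij: "i < length (cols G)" "j < length (cols G)" "i \<noteq> j"
    have "L *\<^sub>v col G i \<noteq> L *\<^sub>v col G j"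
    proof
      assume "L *\<^sub>v col G i = L *\<^sub>v col G j"
      then have "(L * G) $$ (i,i) = (L * G) $$ (i,j)"
        using ij G L by (metis cols_length carrier_matD index_mult_mat(1) index_mult_mat_vec)
      then show False using ij G LG by simp
    qed
    then show "cols G ! i \<noteq> cols G ! j" using ij by auto
  qed
  have indpt: "lin_indpt (set (cols G))"
    using lin_depE[OF G _ dist] inj by metis
  show "mat_rank G = r"
    using lin_indpt_full_rank[OF G dist indpt] G by (simp add: mat_rank_def)
  have "card (set (cols G)) \<le> dim"
    by (rule li_le_dim(2)) (use G cols_dim[of G] indpt in auto)
  then show "r \<le> m" using dist G by (simp add: distinct_card dim_is_n)
qed

text \<open>A factorisation through dimension \<open>r\<close> whose left factor is injective and whose right
  factor is surjective exhibits the rank: the product has the column space of \<open>G\<close>.\<close>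

lemma mat_rank_factorisation:
  fixes G H :: "real mat"
  assumes G: "G \<in> carrier_mat m r" and L: "L \<in> carrier_mat r m" and LG: "L * G = 1\<^sub>m r"
    and H: "H \<in> carrier_mat r p" and R: "R \<in> carrier_mat p r" and HR: "H * R = 1\<^sub>m r"
  shows "mat_rank (G * H) = r"
proof -
  have "mat_range (G * H) = mat_range G"
  proof -
    have "(G * H) *\<^sub>v v \<in> (\<lambda>v. G *\<^sub>v v) ` carrier_vec r" if "v \<in> carrier_vec p" for v
      using assoc_mult_mat_vec[OF G H that] H that by auto
    moreover have "G *\<^sub>v v \<in> (\<lambda>v. (G * H) *\<^sub>v v) ` carrier_vec p" if v: "v \<in> carrier_vec r" for v
    proof
      show "G *\<^sub>v v = (G * H) *\<^sub>v (R *\<^sub>v v)"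
        using assoc_mult_mat_vec[OF G H, of "R *\<^sub>v v"] assoc_mult_mat_vec[OF H R v] HR R v by simp
      show "R *\<^sub>v v \<in> carrier_vec p" using R v by simp
    qed
    ultimately show ?thesis
      unfolding mat_range_eq_image[OF mult_carrier_mat[OF G H]] mat_range_eq_image[OF G]
      by (intro subset_antisym image_subsetI) auto
  qed
  then have "mat_rank (G * H) = mat_rank G"
    using G by (simp add: mat_rank_def mat_range_def vec_space.rank_def vec_space.col_space_def)
  then show ?thesis using mat_rank_left_inverse(1)[OF G L LG] by simp
qed

lemma orthonormal_carrier: "X \<in> orthonormal_mats p q \<Longrightarrow> X \<in> carrier_mat p q"
  by (simp add: orthonormal_mats_def)

lemma orthonormal_dim:
  "X \<in> orthonormal_mats p q \<Longrightarrow> dim_row X = p" "X \<in> orthonormal_mats p q \<Longrightarrow> dim_col X = q"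
  by (auto simp: orthonormal_mats_def)

lemma orthonormal_gram: "X \<in> orthonormal_mats p q \<Longrightarrow> X\<^sup>T * X = 1\<^sub>m q"
  by (simp add: orthonormal_mats_def)

lemma orthonormal_cancel:
  "X \<in> orthonormal_mats p q \<Longrightarrow> dim_row Y = q \<Longrightarrow> X\<^sup>T * (X * Y) = Y"
  using mult_assoc_dim[of "X\<^sup>T" X Y] by (auto simp: orthonormal_mats_def)

lemma orthonormalI: "X \<in> carrier_mat p q \<Longrightarrow> X\<^sup>T * X = 1\<^sub>m q \<Longrightarrow> X \<in> orthonormal_mats p q"
  by (simp add: orthonormal_mats_def)

lemma orthonormal_mult:
  assumes "X \<in> orthonormal_mats p q" and "Y \<in> orthonormal_mats q s"
  shows "X * Y \<in> orthonormal_mats p s"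
  by (rule orthonormalI)
     (use assms in \<open>auto simp: mat_algebra orthonormal_dim orthonormal_cancel orthonormal_gram\<close>)

lemma orthonormal_square_right:
  assumes "Q \<in> orthonormal_mats q q"
  shows "Q * Q\<^sup>T = 1\<^sub>m q"
  using mat_mult_left_right_inverse[of "Q\<^sup>T" q Q] assms by (auto simp: orthonormal_mats_def)

lemma orthonormal_le: "X \<in> orthonormal_mats p q \<Longrightarrow> q \<le> p"
  using mat_rank_left_inverse(2)[of X p q "X\<^sup>T"] by (auto simp: orthonormal_mats_def)

lemma orthonormal_col_scalar_prod:
  assumes "X \<in> orthonormal_mats p q" and "i < q" and "j < q"
  shows "col X i \<bullet> col X j = (if i = j then 1 else 0)"
proof -
  have "(X\<^sup>T * X) $$ (i,j) = col X i \<bullet> col X j"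
    using assms by (simp add: orthonormal_dim)
  then show ?thesis using assms by (simp add: orthonormal_gram)
qed

lemma orthonormalI_cols:
  assumes "X \<in> carrier_mat p q"
    and "\<And>i j. i < q \<Longrightarrow> j < q \<Longrightarrow> col X i \<bullet> col X j = (if i = j then 1 else 0)"
  shows "X \<in> orthonormal_mats p q"
  by (intro orthonormalI eq_matI) (use assms in auto)

text \<open>The matrix \<open>X X\<^sup>T\<close> is the orthogonal projector onto the column space of \<open>X\<close>, so it
  is a complete invariant of that space. This turns the constraint on the column space into a
  matrix equation.\<close>

lemma mat_range_eq_iff_projector_eq:
  assumes X: "X \<in> orthonormal_mats n k" and Y: "Y \<in> orthonormal_mats n l"
  shows "mat_range X = mat_range Y \<longleftrightarrow> X * X\<^sup>T = Y * Y\<^sup>T"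
proof
  note dims = X[THEN orthonormal_dim(1)] X[THEN orthonormal_dim(2)]
    Y[THEN orthonormal_dim(1)] Y[THEN orthonormal_dim(2)]
  have absorb: "V * (V\<^sup>T * U) = U" if U: "U \<in> orthonormal_mats n a" and V: "V \<in> orthonormal_mats n b"
    and sub: "mat_range U \<subseteq> mat_range V" for U V a b
  proof (rule mat_col_eqI)
    fix j assume "j < dim_col U"
    then have j: "j < a" using U by (simp add: orthonormal_dim)
    have "col U j = U *\<^sub>v unit_vec a j"
      using U j by (intro eq_vecI) (auto simp: orthonormal_dim)
    then have "col U j \<in> mat_range U"
      unfolding mat_range_eq_image[OF orthonormal_carrier[OF U]] by auto
    then obtain v where v: "v \<in> carrier_vec b" and eq: "col U j = V *\<^sub>v v"
      using sub mat_range_eq_image[OF orthonormal_carrier[OF V]] by auto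
    have "col (V * (V\<^sup>T * U)) j = V *\<^sub>v (V\<^sup>T *\<^sub>v col U j)"
      using U V j by (simp add: col_mult_dim orthonormal_dim)
    also have "\<dots> = V *\<^sub>v ((V\<^sup>T * V) *\<^sub>v v)"
      using V v by (simp add: eq mult_mat_vec_assoc_dim orthonormal_dim)
    also have "\<dots> = col U j" using V v by (simp add: eq orthonormal_gram)
    finally show "col (V * (V\<^sup>T * U)) j = col U j" .
  qed (use that in \<open>auto simp: orthonormal_dim\<close>)
  {
    (* Each projector fixes the range of the other; transposing one of the two resulting
       equations, both of whose factors are symmetric, compares the projectors. *)
    assume eq: "mat_range X = mat_range Y"
    have "X * X\<^sup>T = Y * (Y\<^sup>T * X) * X\<^sup>T"
      using absorb[OF X Y] eq by simp
    also have "\<dots> = (X * (X\<^sup>T * Y) * Y\<^sup>T)\<^sup>T"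
      using dims by (simp add: mat_algebra)
    also have "X * (X\<^sup>T * Y) * Y\<^sup>T = Y * Y\<^sup>T"
      using absorb[OF Y X] eq by simp
    also have "(Y * Y\<^sup>T)\<^sup>T = Y * Y\<^sup>T" using dims by (simp add: mat_algebra)
    finally show "X * X\<^sup>T = Y * Y\<^sup>T" .
  }
  {
    have sub: "mat_range U \<subseteq> mat_range V"
      if U: "U \<in> orthonormal_mats n a" and V: "V \<in> orthonormal_mats n b"
      and eq: "U * U\<^sup>T = V * V\<^sup>T" for U V a b
    proof -
      have "U *\<^sub>v v \<in> (\<lambda>v. V *\<^sub>v v) ` carrier_vec b" if v: "v \<in> carrier_vec a" for v
      proof
        have "V * (V\<^sup>T * U) = U * U\<^sup>T * U"
          using U V by (simp add: eq orthonormal_dim flip: mult_assoc_dim)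
        also have "\<dots> = U"
          using U by (simp add: mult_assoc_dim orthonormal_dim orthonormal_gram)
        finally have "U = V * (V\<^sup>T * U)" ..
        then have "U *\<^sub>v v = (V * (V\<^sup>T * U)) *\<^sub>v v" by simp
        then show "U *\<^sub>v v = V *\<^sub>v ((V\<^sup>T * U) *\<^sub>v v)"
          using U V v by (simp add: mult_mat_vec_assoc_dim orthonormal_dim)
        show "(V\<^sup>T * U) *\<^sub>v v \<in> carrier_vec b"
          using V by (intro carrier_vecI) (simp add: orthonormal_dim)
      qed
      then show ?thesis
        using mat_range_eq_image[OF orthonormal_carrier[OF U]]
          mat_range_eq_image[OF orthonormal_carrier[OF V]] by auto
    qed
    assume "X * X\<^sup>T = Y * Y\<^sup>T"
    then show "mat_range X = mat_range Y" using sub[OF X Y] sub[OF Y X] by auto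
  }
qed

section \<open>Singular value decomposition\<close>

text \<open>A real symmetric matrix, read as a complex one, has an eigenvector \<open>a + i b\<close>. Symmetry
  forces its eigenvalue to be real, and then \<open>a\<close> and \<open>b\<close> are eigenvectors unless they vanish.\<close>

lemma symmetric_unit_eigenvector:
  fixes M :: "real mat"
  assumes M: "M \<in> carrier_mat m m" and sym: "M\<^sup>T = M" and m: "0 < m"
  shows "\<exists>\<mu> v. v \<in> carrier_vec m \<and> v \<bullet> v = 1 \<and> M *\<^sub>v v = \<mu> \<cdot>\<^sub>v v"
proof -
  define C where "C = map_mat complex_of_real M"
  have C: "C \<in> carrier_mat m m" using M by (simp add: C_def)
  obtain l where "l \<in> spectrum C" using spectrum_non_empty[OF C m] by blast
  then obtain z where z: "z \<in> carrier_vec m" "z \<noteq> 0\<^sub>v m" and Cz: "C *\<^sub>v z = l \<cdot>\<^sub>v z"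
    using C by (auto simp: spectrum_def eigenvalue_def eigenvector_def)
  define a where "a = map_vec Re z"
  define b where "b = map_vec Im z"
  have ab: "a \<in> carrier_vec m" "b \<in> carrier_vec m" using z by (simp_all add: a_def b_def)
  have Czi: "(\<Sum>j<m. complex_of_real (M $$ (i,j)) * z $ j) = l * z $ i" if "i < m" for i
  proof -
    have "(C *\<^sub>v z) $ i = (l \<cdot>\<^sub>v z) $ i" by (simp add: Cz)
    then show ?thesis
      using that M z by (simp add: C_def scalar_prod_def lessThan_atLeast0)
  qed
  have Ma: "M *\<^sub>v a = Re l \<cdot>\<^sub>v a - Im l \<cdot>\<^sub>v b"
  proof (rule eq_vecI)
    fix i assume "i < dim_vec (Re l \<cdot>\<^sub>v a - Im l \<cdot>\<^sub>v b)"
    then have i: "i < m" using ab by simp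
    have "(M *\<^sub>v a) $ i = Re (\<Sum>j<m. complex_of_real (M $$ (i,j)) * z $ j)"
      using i M z by (simp add: a_def scalar_prod_def lessThan_atLeast0)
    then show "(M *\<^sub>v a) $ i = (Re l \<cdot>\<^sub>v a - Im l \<cdot>\<^sub>v b) $ i"
      using i z by (simp add: Czi[OF i] a_def b_def)
  qed (use ab M in auto)
  have Mb: "M *\<^sub>v b = Im l \<cdot>\<^sub>v a + Re l \<cdot>\<^sub>v b"
  proof (rule eq_vecI)
    fix i assume "i < dim_vec (Im l \<cdot>\<^sub>v a + Re l \<cdot>\<^sub>v b)"
    then have i: "i < m" using ab by simp
    have "(M *\<^sub>v b) $ i = Im (\<Sum>j<m. complex_of_real (M $$ (i,j)) * z $ j)"
      using i M z by (simp add: b_def scalar_prod_def lessThan_atLeast0)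
    then show "(M *\<^sub>v b) $ i = (Im l \<cdot>\<^sub>v a + Re l \<cdot>\<^sub>v b) $ i"
      using i z by (simp add: Czi[OF i] a_def b_def)
  qed (use ab M in auto)
  have nz: "a \<noteq> 0\<^sub>v m \<or> b \<noteq> 0\<^sub>v m"
  proof (rule ccontr)
    assume "\<not> ?thesis"
    then have "Re (z $ i) = 0 \<and> Im (z $ i) = 0" if "i < m" for i
      using that z by (metis a_def b_def carrier_vecD index_map_vec(1) index_zero_vec(1))
    then have "z = 0\<^sub>v m" using z by (intro eq_vecI) (auto simp: complex_eq_iff)
    with z show False by simp
  qed
  have "b \<bullet> (M *\<^sub>v a) = a \<bullet> (M *\<^sub>v b)"
    using transpose_vec_mult_scalar[OF M ab(1) ab(2)] sym ab M
    by (metis comm_scalar_prod mult_mat_vec_carrier)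
  then have "Im l * (a \<bullet> a + b \<bullet> b) = 0"
    using ab comm_scalar_prod[of a m b] unfolding Ma Mb
    by (simp add: scalar_prod_minus_distrib[of _ m] scalar_prod_add_distrib[of _ m] algebra_simps)
  moreover have "a \<bullet> a + b \<bullet> b \<noteq> 0"
    using nz scalar_prod_self_nonneg[of a] scalar_prod_self_nonneg[of b]
      scalar_prod_self_eq_0[of a] scalar_prod_self_eq_0[of b] ab by (auto simp: add_nonneg_eq_0_iff)
  ultimately have "Im l = 0" by simp
  then have eig: "M *\<^sub>v a = Re l \<cdot>\<^sub>v a" "M *\<^sub>v b = Re l \<cdot>\<^sub>v b"
    unfolding Ma Mb using ab by (auto intro!: eq_vecI)
  obtain v where v: "v \<in> carrier_vec m" "v \<noteq> 0\<^sub>v m" "M *\<^sub>v v = Re l \<cdot>\<^sub>v v"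
    using nz ab eig by blast
  obtain c where c: "(c \<cdot>\<^sub>v v) \<bullet> (c \<cdot>\<^sub>v v) = 1" using ex_unit_multiple[OF v(1,2)] by blast
  have "M *\<^sub>v (c \<cdot>\<^sub>v v) = Re l \<cdot>\<^sub>v (c \<cdot>\<^sub>v v)"
    using v M by (simp add: mult_mat_vec smult_smult_assoc mult.commute)
  then show ?thesis using v(1) c by (intro exI[of _ "Re l"] exI[of _ "c \<cdot>\<^sub>v v"]) simp
qed

text \<open>Any unit vector \<open>u\<close> is the first column of an orthogonal matrix: the Householder
  reflection that swaps \<open>u\<close> and the first unit vector.\<close>

lemma ex_orthonormal_with_first_col:
  fixes u :: "real vec"
  assumes u: "u \<in> carrier_vec (Suc m)" and unit: "u \<bullet> u = 1"
  shows "\<exists>H \<in> orthonormal_mats (Suc m) (Suc m). col H 0 = u"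
proof (cases "u = unit_vec (Suc m) 0")
  case True
  then show ?thesis
    by (intro bexI[of _ "1\<^sub>m (Suc m)"]) (auto simp: orthonormal_mats_def)
next
  case False
  let ?n = "Suc m"
  have uu: "(\<Sum>l<?n. u $ l * u $ l) = 1"
    using unit u by (simp add: scalar_prod_def lessThan_atLeast0)
  have u0: "u $ 0 \<noteq> 1"
  proof
    assume 1: "u $ 0 = 1"
    have "(\<Sum>l<m. u $ Suc l * u $ Suc l) = 0"
      using uu unfolding sum.lessThan_Suc_shift by (simp add: 1)
    then have "\<forall>l<m. u $ Suc l = 0" by (subst (asm) sum_nonneg_eq_0_iff) auto
    then have "u = unit_vec ?n 0"
      using u 1 by (intro eq_vecI) (auto simp: less_Suc_eq_0_disj)
    with False show False by simp
  qed
  define v where "v i = u $ i - (if i = 0 then 1 else 0)" for i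
  (* This is 2 / (v . v), because v . v = 2 (1 - u_0) for the unit vector u. *)
  define c where "c = 1 / (1 - u $ 0)"
  have vv: "(\<Sum>l<?n. v l * v l) = 2 / c"
  proof -
    have "(\<Sum>l<?n. v l * v l) = (u $ 0 - 1) * (u $ 0 - 1) + (\<Sum>l<m. u $ Suc l * u $ Suc l)"
      unfolding sum.lessThan_Suc_shift by (simp add: v_def)
    also have "(\<Sum>l<m. u $ Suc l * u $ Suc l) = 1 - u $ 0 * u $ 0"
      using uu unfolding sum.lessThan_Suc_shift by simp
    finally show ?thesis using u0 by (simp add: c_def field_simps)
  qed
  have c0: "c \<noteq> 0" using u0 by (simp add: c_def)
  define H where "H = mat ?n ?n (\<lambda>(i,j). (if i = j then 1 else 0) - c * v i * v j)"
  have "H \<in> orthonormal_mats ?n ?n"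
  proof (rule orthonormalI_cols)
    fix i j assume ij: "i < ?n" "j < ?n"
    have "col H i \<bullet> col H j = (\<Sum>l<?n. ((if l = i then 1 else 0) - c * v l * v i)
        * ((if l = j then 1 else 0) - c * v l * v j))"
      using ij by (simp add: H_def scalar_prod_def lessThan_atLeast0)
    also have "\<dots> = (\<Sum>l<?n. (if l = i then (if l = j then 1 else 0) else 0)
        - (if l = i then c * v l * v j else 0) - (if l = j then c * v l * v i else 0)
        + c * c * v i * v j * (v l * v l))"
      by (intro sum.cong) (auto simp: algebra_simps)
    also have "\<dots> = (if i = j then 1 else 0) - 2 * c * v i * v j
        + c * c * v i * v j * (\<Sum>l<?n. v l * v l)"
      using ij by (simp add: sum.distrib sum_subtractf sum.delta' flip: sum_distrib_left)
    also have "\<dots> = (if i = j then 1 else 0)" unfolding vv using c0 by simp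
    finally show "col H i \<bullet> col H j = (if i = j then 1 else 0)" .
  qed (simp add: H_def)
  moreover have "col H 0 = u"
  proof (rule eq_vecI)
    fix i assume "i < dim_vec u"
    then have "i < ?n" using u by simp
    moreover have "c * v 0 = - 1" using u0 by (simp add: c_def v_def field_simps)
    moreover have "c * v i * v 0 = c * v 0 * v i" by simp
    ultimately show "col H 0 $ i = u $ i"
      by (simp add: H_def) (simp add: v_def)
  qed (use u in \<open>simp add: H_def\<close>)
  ultimately show ?thesis by blast
qed

text \<open>A unit eigenvector \<open>w\<close> of \<open>M\<^sup>T M\<close> with eigenvalue \<open>\<mu>\<close> gives \<open>\<sigma> = sqrt \<mu>\<close> and
  \<open>u = M w / \<sigma>\<close>. For \<open>\<sigma> = 0\<close> any unit vector in the kernel of \<open>M\<^sup>T\<close> serves as \<open>u\<close>; there is one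
  because \<open>M w = 0\<close> makes the square matrix \<open>M\<close> singular.\<close>

lemma ex_singular_triple:
  fixes M :: "real mat"
  assumes M: "M \<in> carrier_mat m m" and m: "0 < m"
  shows "\<exists>\<sigma> u w. 0 \<le> \<sigma> \<and> u \<in> carrier_vec m \<and> w \<in> carrier_vec m \<and> u \<bullet> u = 1 \<and> w \<bullet> w = 1
    \<and> M *\<^sub>v w = \<sigma> \<cdot>\<^sub>v u \<and> M\<^sup>T *\<^sub>v u = \<sigma> \<cdot>\<^sub>v w"
proof -
  have "M\<^sup>T * M \<in> carrier_mat m m" "(M\<^sup>T * M)\<^sup>T = M\<^sup>T * M" using M by (auto simp: transpose_mult_dim)
  from symmetric_unit_eigenvector[OF this m] obtain \<mu> w where
    w: "w \<in> carrier_vec m" "w \<bullet> w = 1" and eig: "(M\<^sup>T * M) *\<^sub>v w = \<mu> \<cdot>\<^sub>v w" by blast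
  have Mw: "M *\<^sub>v w \<in> carrier_vec m" using M w by simp
  have MMw: "M\<^sup>T *\<^sub>v (M *\<^sub>v w) = \<mu> \<cdot>\<^sub>v w" using eig M w by (simp add: mult_mat_vec_assoc_dim)
  have "\<mu> = (\<mu> \<cdot>\<^sub>v w) \<bullet> w" using w by simp
  also have "\<dots> = (M *\<^sub>v w) \<bullet> (M *\<^sub>v w)"
    using transpose_vec_mult_scalar[OF M w(1) Mw] by (simp add: MMw)
  finally have \<mu>: "\<mu> = (M *\<^sub>v w) \<bullet> (M *\<^sub>v w)" .
  show ?thesis
  proof (cases "\<mu> = 0")
    case False
    then have pos: "\<mu> > 0" using \<mu> scalar_prod_self_nonneg[of "M *\<^sub>v w"] by simp
    define u where "u = (1 / sqrt \<mu>) \<cdot>\<^sub>v (M *\<^sub>v w)"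
    have "u \<bullet> u = 1" using pos Mw \<mu> by (simp add: u_def field_simps)
    moreover have "M *\<^sub>v w = sqrt \<mu> \<cdot>\<^sub>v u" using pos by (simp add: u_def smult_smult_assoc)
    moreover have "M\<^sup>T *\<^sub>v u = sqrt \<mu> \<cdot>\<^sub>v w"
      using pos M Mw MMw by (simp add: u_def mult_mat_vec[of _ m m] smult_smult_assoc real_div_sqrt)
    moreover have "u \<in> carrier_vec m" using Mw by (simp add: u_def)
    moreover have "0 \<le> sqrt \<mu>" using pos by simp
    ultimately show ?thesis using w by blast
  next
    case True
    then have Mw0: "M *\<^sub>v w = 0\<^sub>v m" using \<mu> scalar_prod_self_eq_0[of "M *\<^sub>v w"] M by simp
    have "w \<noteq> 0\<^sub>v m" using w by auto
    then have "det M\<^sup>T = 0" using Mw0 w(1) det_0_iff_vec_prod_zero[OF M] det_transpose[OF M] by auto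
    then obtain v where v: "v \<in> carrier_vec m" "v \<noteq> 0\<^sub>v m" "M\<^sup>T *\<^sub>v v = 0\<^sub>v m"
      using det_0_iff_vec_prod_zero[of "M\<^sup>T" m] M by auto
    obtain c where c: "(c \<cdot>\<^sub>v v) \<bullet> (c \<cdot>\<^sub>v v) = 1" using ex_unit_multiple[OF v(1,2)] by blast
    have "M\<^sup>T *\<^sub>v (c \<cdot>\<^sub>v v) = 0 \<cdot>\<^sub>v w"
      using v M w by (auto simp: mult_mat_vec[of _ m m])
    moreover have "M *\<^sub>v w = 0 \<cdot>\<^sub>v (c \<cdot>\<^sub>v v)" using Mw0 v by auto
    ultimately show ?thesis
      using v w c by (intro exI[of _ 0] exI[of _ "c \<cdot>\<^sub>v v"] exI[of _ w]) simp
  qed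
qed

text \<open>Deflation: in orthonormal bases that start with a singular pair, \<open>M\<close> splits off a
  \<open>1 \<times> 1\<close> block.\<close>

lemma singular_value_decomposition:
  fixes M :: "real mat"
  assumes "M \<in> carrier_mat m m"
  shows "\<exists>U \<in> orthonormal_mats m m. \<exists>W \<in> orthonormal_mats m m. \<exists>s.
    (\<forall>i. 0 \<le> s i) \<and> U\<^sup>T * M * W = mat_diag m s"
  using assms
proof (induction m arbitrary: M)
  case 0
  then show ?case
    by (intro bexI[of _ "1\<^sub>m 0"] exI[of _ "\<lambda>_. 0"]) (auto simp: orthonormal_mats_def mat_diag_def)
next
  case (Suc m)
  note M = Suc.prems
  let ?n = "Suc m"
  obtain \<sigma> u w where \<sigma>: "0 \<le> \<sigma>" and u: "u \<in> carrier_vec ?n" "u \<bullet> u = 1"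
    and w: "w \<in> carrier_vec ?n" "w \<bullet> w = 1"
    and Mw: "M *\<^sub>v w = \<sigma> \<cdot>\<^sub>v u" and Mu: "M\<^sup>T *\<^sub>v u = \<sigma> \<cdot>\<^sub>v w"
    using ex_singular_triple[OF M] by blast
  obtain H where H: "H \<in> orthonormal_mats ?n ?n" "col H 0 = u"
    using ex_orthonormal_with_first_col[OF u] by blast
  obtain G where G: "G \<in> orthonormal_mats ?n ?n" "col G 0 = w"
    using ex_orthonormal_with_first_col[OF w] by blast
  note dims = H(1)[THEN orthonormal_dim(1)] H(1)[THEN orthonormal_dim(2)]
    G(1)[THEN orthonormal_dim(1)] G(1)[THEN orthonormal_dim(2)]
  define N where "N = H\<^sup>T * M * G"
  have N: "N \<in> carrier_mat ?n ?n" using dims M by (auto simp: N_def)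
  have N_entry: "N $$ (i,j) = col H i \<bullet> (M *\<^sub>v col G j)" if "i < ?n" "j < ?n" for i j
  proof -
    have "N = H\<^sup>T * (M * G)" using dims M by (simp add: N_def mult_assoc_dim)
    then show ?thesis using that dims M by (simp add: col_mult_dim)
  qed
  have N_col: "N $$ (i,0) = (if i = 0 then \<sigma> else 0)" if "i < ?n" for i
  proof -
    have "col H i \<in> carrier_vec ?n" using dims by (intro carrier_vecI) simp
    then show ?thesis
      using that orthonormal_col_scalar_prod[OF H(1) that, of 0] u
      by (simp add: N_entry G(2) Mw H(2))
  qed
  have N_row: "N $$ (0,j) = (if j = 0 then \<sigma> else 0)" if "j < ?n" for j
  proof -
    have cj: "col G j \<in> carrier_vec ?n" using dims by (intro carrier_vecI) simp
    have "u \<bullet> (M *\<^sub>v col G j) = (M\<^sup>T *\<^sub>v u) \<bullet> col G j"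
      using transpose_vec_mult_scalar[OF M cj u(1)] by simp
    also have "\<dots> = \<sigma> * (w \<bullet> col G j)" using w cj by (simp add: Mu)
    finally show ?thesis
      using that orthonormal_col_scalar_prod[OF G(1) _ that, of 0] by (simp add: N_entry H(2) G(2))
  qed
  define N' where "N' = mat m m (\<lambda>(i,j). N $$ (Suc i, Suc j))"
  have N': "N' \<in> carrier_mat m m" by (simp add: N'_def)
  let ?a = "mat 1 1 (\<lambda>_. \<sigma>)"
  have N_block: "N = four_block_mat ?a (0\<^sub>m 1 m) (0\<^sub>m m 1) N'"
    by (rule eq_matI) (use N N_col N_row in \<open>auto simp: N'_def\<close>)
  obtain U' W' s where U': "U' \<in> orthonormal_mats m m" and W': "W' \<in> orthonormal_mats m m"
    and s: "\<forall>i. 0 \<le> s i" and diag: "U'\<^sup>T * N' * W' = mat_diag m s"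
    using Suc.IH[OF N'] by blast
  note carrier' = U'[THEN orthonormal_carrier] W'[THEN orthonormal_carrier]
  let ?block = "\<lambda>V. four_block_mat (1\<^sub>m 1) (0\<^sub>m 1 m) (0\<^sub>m m 1) V"
  have block: "?block V \<in> orthonormal_mats ?n ?n" if V: "V \<in> orthonormal_mats m m" for V :: "real mat"
  proof (rule orthonormalI)
    have Vc: "V \<in> carrier_mat m m" by (rule orthonormal_carrier[OF V])
    show "?block V \<in> carrier_mat ?n ?n" using four_block_carrier_mat[of "1\<^sub>m 1" 1 1 V m m] Vc by auto
    have "(?block V)\<^sup>T * ?block V = ?block (V\<^sup>T * V)"
      using Vc by (simp add: transpose_four_block_mat[of _ 1 1 _ m _ m] mult_four_block_mat[of _ 1 1 _ m _ m _ _ 1 _ m])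
    then show "(?block V)\<^sup>T * ?block V = 1\<^sub>m ?n"
      by (simp add: orthonormal_gram[OF V])
  qed
  define U\<^sub>1 where "U\<^sub>1 = ?block U'"
  define W\<^sub>1 where "W\<^sub>1 = ?block W'"
  have UW\<^sub>1: "U\<^sub>1 \<in> orthonormal_mats ?n ?n" "W\<^sub>1 \<in> orthonormal_mats ?n ?n"
    unfolding U\<^sub>1_def W\<^sub>1_def by (rule block[OF U'], rule block[OF W'])
  note dims\<^sub>1 = UW\<^sub>1[THEN orthonormal_dim(1)] UW\<^sub>1[THEN orthonormal_dim(2)]
  have UW: "H * U\<^sub>1 \<in> orthonormal_mats ?n ?n" "G * W\<^sub>1 \<in> orthonormal_mats ?n ?n"
    by (rule orthonormal_mult[OF H(1) UW\<^sub>1(1)], rule orthonormal_mult[OF G(1) UW\<^sub>1(2)])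
  have "(H * U\<^sub>1)\<^sup>T * M * (G * W\<^sub>1) = U\<^sub>1\<^sup>T * N * W\<^sub>1"
    using dims dims\<^sub>1 carrier_matD[OF M] unfolding N_def by (simp add: mat_algebra)
  also have "\<dots> = four_block_mat ?a (0\<^sub>m 1 m) (0\<^sub>m m 1) (U'\<^sup>T * N' * W')"
    using carrier' N' unfolding N_block U\<^sub>1_def W\<^sub>1_def
    by (simp add: transpose_four_block_mat[of _ 1 1 _ m _ m] mult_four_block_mat[of _ 1 1 _ m _ m _ _ 1 _ m])
  also have "\<dots> = mat_diag ?n (\<lambda>i. if i = 0 then \<sigma> else s (i - 1))"
    unfolding diag by (rule eq_matI) (auto simp: mat_diag_def)
  finally show ?case
    using \<sigma> s by (intro bexI[OF _ UW(1)] bexI[OF _ UW(2)]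
        exI[of _ "\<lambda>i. if i = 0 then \<sigma> else s (i - 1)"]) auto
qed

section \<open>Splitting an orthonormal basis in two\<close>

text \<open>\<open>P\<^sub>1\<close> and \<open>P\<^sub>2\<close> together hold \<open>r\<close> and \<open>k - r\<close> vectors of an orthonormal basis of the
  range of the projector \<open>Pr\<close>.\<close>

definition orthonormal_split ::
  "nat \<Rightarrow> nat \<Rightarrow> nat \<Rightarrow> real mat \<Rightarrow> real mat \<Rightarrow> real mat \<Rightarrow> bool" where
  "orthonormal_split n k r P\<^sub>1 P\<^sub>2 Pr \<longleftrightarrow>
     P\<^sub>1 \<in> orthonormal_mats n r \<and> P\<^sub>2 \<in> orthonormal_mats n (k - r) \<and>
     P\<^sub>1\<^sup>T * P\<^sub>2 = 0\<^sub>m r (k - r) \<and> P\<^sub>1 * P\<^sub>1\<^sup>T + P\<^sub>2 * P\<^sub>2\<^sup>T = Pr"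

lemma zero_mult_dim: "dim_row M = b \<Longrightarrow> 0\<^sub>m a b * M = 0\<^sub>m a (dim_col M)" for M :: "real mat"
  by (rule left_mult_zero_mat) auto

lemma mult_zero_dim: "dim_col M = b \<Longrightarrow> M * 0\<^sub>m b c = 0\<^sub>m (dim_row M) c" for M :: "real mat"
  by (rule right_mult_zero_mat) auto

lemma add_zero_dim:
  fixes M :: "real mat"
  shows "dim_row M = a \<Longrightarrow> dim_col M = b \<Longrightarrow> M + 0\<^sub>m a b = M"
    and "dim_row M = a \<Longrightarrow> dim_col M = b \<Longrightarrow> 0\<^sub>m a b + M = M"
  by (auto intro: right_add_zero_mat left_add_zero_mat)

lemma one_mult_dim:
  fixes M :: "real mat"
  shows "dim_row M = a \<Longrightarrow> 1\<^sub>m a * M = M" and "dim_col M = a \<Longrightarrow> M * 1\<^sub>m a = M"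
  by (auto intro: left_mult_one_mat right_mult_one_mat)

lemmas mat_units = zero_mult_dim mult_zero_dim add_zero_dim one_mult_dim

lemma orthonormal_splitD:
  assumes "orthonormal_split n k r P\<^sub>1 P\<^sub>2 Pr"
  shows "P\<^sub>1 \<in> orthonormal_mats n r" and "P\<^sub>2 \<in> orthonormal_mats n (k - r)"
    and "dim_row P\<^sub>1 = n" and "dim_col P\<^sub>1 = r" and "dim_row P\<^sub>2 = n" and "dim_col P\<^sub>2 = k - r"
    and "P\<^sub>1\<^sup>T * P\<^sub>1 = 1\<^sub>m r" and "P\<^sub>2\<^sup>T * P\<^sub>2 = 1\<^sub>m (k - r)"
    and "P\<^sub>1\<^sup>T * P\<^sub>2 = 0\<^sub>m r (k - r)" and "P\<^sub>2\<^sup>T * P\<^sub>1 = 0\<^sub>m (k - r) r"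
    and "P\<^sub>1 * P\<^sub>1\<^sup>T + P\<^sub>2 * P\<^sub>2\<^sup>T = Pr"
proof -
  show 1: "P\<^sub>1 \<in> orthonormal_mats n r" "P\<^sub>2 \<in> orthonormal_mats n (k - r)"
    and 2: "P\<^sub>1\<^sup>T * P\<^sub>2 = 0\<^sub>m r (k - r)" and "P\<^sub>1 * P\<^sub>1\<^sup>T + P\<^sub>2 * P\<^sub>2\<^sup>T = Pr"
    using assms by (simp_all add: orthonormal_split_def)
  show "dim_row P\<^sub>1 = n" "dim_col P\<^sub>1 = r" "dim_row P\<^sub>2 = n" "dim_col P\<^sub>2 = k - r"
    "P\<^sub>1\<^sup>T * P\<^sub>1 = 1\<^sub>m r" "P\<^sub>2\<^sup>T * P\<^sub>2 = 1\<^sub>m (k - r)"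
    using 1 by (simp_all add: orthonormal_dim orthonormal_gram)
  have "P\<^sub>2\<^sup>T * P\<^sub>1 = (P\<^sub>1\<^sup>T * P\<^sub>2)\<^sup>T" using 1 by (simp add: transpose_mult_dim orthonormal_dim)
  then show "P\<^sub>2\<^sup>T * P\<^sub>1 = 0\<^sub>m (k - r) r" by (simp add: 2)
qed

lemma orthonormal_split_cancel:
  assumes "orthonormal_split n k r P\<^sub>1 P\<^sub>2 Pr"
  shows "dim_row Y = r \<Longrightarrow> P\<^sub>1\<^sup>T * (P\<^sub>1 * Y) = Y" and "dim_row Z = k - r \<Longrightarrow> P\<^sub>2\<^sup>T * (P\<^sub>2 * Z) = Z"
    and "dim_row Z = k - r \<Longrightarrow> P\<^sub>1\<^sup>T * (P\<^sub>2 * Z) = 0\<^sub>m r (dim_col Z)"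
    and "dim_row Y = r \<Longrightarrow> P\<^sub>2\<^sup>T * (P\<^sub>1 * Y) = 0\<^sub>m (k - r) (dim_col Y)"
  using orthonormal_splitD[OF assms] mult_assoc_dim[of "P\<^sub>1\<^sup>T" P\<^sub>1 Y] mult_assoc_dim[of "P\<^sub>2\<^sup>T" P\<^sub>2 Z]
    mult_assoc_dim[of "P\<^sub>1\<^sup>T" P\<^sub>2 Z] mult_assoc_dim[of "P\<^sub>2\<^sup>T" P\<^sub>1 Y]
  by (simp_all add: mat_units)

lemma orthonormal_split_mult_left:
  assumes X: "X \<in> orthonormal_mats n k" and U: "orthonormal_split k k r U\<^sub>1 U\<^sub>2 (1\<^sub>m k)"
  shows "orthonormal_split n k r (X * U\<^sub>1) (X * U\<^sub>2) (X * X\<^sup>T)"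
proof -
  note D = orthonormal_splitD[OF U] and dimX = orthonormal_dim[OF X]
  have "X * U\<^sub>1 * (X * U\<^sub>1)\<^sup>T + X * U\<^sub>2 * (X * U\<^sub>2)\<^sup>T = X * ((U\<^sub>1 * U\<^sub>1\<^sup>T + U\<^sub>2 * U\<^sub>2\<^sup>T) * X\<^sup>T)"
    using D(3-6) dimX by (simp add: mat_algebra)
  also have "\<dots> = X * X\<^sup>T" using D(11) dimX by (simp add: mat_units)
  finally have "X * U\<^sub>1 * (X * U\<^sub>1)\<^sup>T + X * U\<^sub>2 * (X * U\<^sub>2)\<^sup>T = X * X\<^sup>T" .
  moreover have "(X * U\<^sub>1)\<^sup>T * (X * U\<^sub>2) = 0\<^sub>m r (k - r)"
    using D(3-6,9) dimX by (simp add: mat_algebra orthonormal_cancel[OF X])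
  ultimately show ?thesis
    unfolding orthonormal_split_def
    using orthonormal_mult[OF X D(1)] orthonormal_mult[OF X D(2)] by blast
qed

text \<open>Multiplication by this matrix from the right selects the columns \<open>f 0, \<dots>, f (p - 1)\<close>, so
  that the singular values need not be sorted.\<close>

definition selector_mat :: "nat \<Rightarrow> nat \<Rightarrow> (nat \<Rightarrow> nat) \<Rightarrow> real mat" where
  "selector_mat k p f = mat k p (\<lambda>(i,j). if i = f j then 1 else 0)"

lemma selector_mat_sandwich:
  assumes f: "bij_betw f {..<p} I"
  shows "selector_mat k p f * mat_diag p (\<lambda>j. s (f j)) * (selector_mat k p f)\<^sup>T
    = mat_diag k (\<lambda>i. if i \<in> I then s i else 0)"
proof (rule eq_matI)
  have fin: "finite I" using f bij_betw_finite by blast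
  have left: "selector_mat k p f * mat_diag p (\<lambda>j. s (f j))
      = mat k p (\<lambda>(i,j). if i = f j then s i else 0)"
    by (subst mat_diag_mult_right[of _ k]) (auto simp: selector_mat_def intro!: eq_matI)
  fix i l
  assume "i < dim_row (mat_diag k (\<lambda>i. if i \<in> I then s i else 0))"
    and "l < dim_col (mat_diag k (\<lambda>i. if i \<in> I then s i else 0))"
  then have il: "i < k" "l < k" by (simp_all add: mat_diag_def)
  have "(selector_mat k p f * mat_diag p (\<lambda>j. s (f j)) * (selector_mat k p f)\<^sup>T) $$ (i,l)
    = (\<Sum>j<p. (if i = f j then s i else 0) * (if l = f j then 1 else 0))"
    unfolding left using il by (simp add: selector_mat_def scalar_prod_def lessThan_atLeast0)
  also have "\<dots> = (\<Sum>x\<in>I. (if i = x then s i else 0) * (if l = x then 1 else 0))"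
    by (rule sum.reindex_bij_betw[OF f])
  also have "\<dots> = (\<Sum>x\<in>I. if x = i then (if i = l then s i else 0) else 0)"
    by (rule sum.cong) auto
  also have "\<dots> = mat_diag k (\<lambda>i. if i \<in> I then s i else 0) $$ (i,l)"
    using il fin by (auto simp: mat_diag_def)
  finally show "(selector_mat k p f * mat_diag p (\<lambda>j. s (f j)) * (selector_mat k p f)\<^sup>T) $$ (i,l)
    = mat_diag k (\<lambda>i. if i \<in> I then s i else 0) $$ (i,l)" .
qed (simp_all add: selector_mat_def mat_diag_def)

lemma selector_mat_split:
  assumes f: "bij_betw f {..<r} I" and g: "bij_betw g {..<k - r} ({..<k} - I)" and I: "I \<subseteq> {..<k}"
  shows "orthonormal_split k k r (selector_mat k r f) (selector_mat k (k - r) g) (1\<^sub>m k)"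
proof -
  have gram: "((selector_mat k p a)\<^sup>T * selector_mat k q b) $$ (i,j) = (if a i = b j then 1 else 0)"
    if "i < p" "j < q" "a i < k" for p q a b i j
  proof -
    have "((selector_mat k p a)\<^sup>T * selector_mat k q b) $$ (i,j)
      = (\<Sum>l<k. (if l = a i then 1 else 0) * (if l = b j then 1 else 0))"
      using that by (simp add: selector_mat_def scalar_prod_def lessThan_atLeast0)
    also have "\<dots> = (\<Sum>l<k. if l = a i then (if a i = b j then 1 else 0) else 0)"
      by (rule sum.cong) auto
    finally show ?thesis using that by simp
  qed
  have fi: "f i \<in> I" if "i < r" for i using f that by (auto simp: bij_betw_def)
  have gi: "g i < k" "g i \<notin> I" if "i < k - r" for i using g that by (auto simp: bij_betw_def)
  have inj: "f i = f j \<longleftrightarrow> i = j" if "i < r" "j < r" for i j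
    using f that by (auto simp: bij_betw_def inj_on_def)
  have injg: "g i = g j \<longleftrightarrow> i = j" if "i < k - r" "j < k - r" for i j
    using g that by (auto simp: bij_betw_def inj_on_def)
  have one: "selector_mat k p h * (selector_mat k p h)\<^sup>T = mat_diag k (\<lambda>i. if i \<in> J then 1 else 0)"
    if "bij_betw h {..<p} J" for p h J
    using selector_mat_sandwich[OF that, of k "\<lambda>_. 1"]
    by (simp add: one_mult_dim selector_mat_def)
  have "selector_mat k r f * (selector_mat k r f)\<^sup>T
      + selector_mat k (k - r) g * (selector_mat k (k - r) g)\<^sup>T = 1\<^sub>m k"
    unfolding one[OF f] one[OF g] using I by (intro eq_matI) (auto simp: mat_diag_def)
  moreover have "selector_mat k r f \<in> orthonormal_mats k r"
  proof (rule orthonormalI)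
    show "(selector_mat k r f)\<^sup>T * selector_mat k r f = 1\<^sub>m r"
    proof (rule eq_matI)
      fix i j assume "i < dim_row (1\<^sub>m r :: real mat)" "j < dim_col (1\<^sub>m r :: real mat)"
      then show "((selector_mat k r f)\<^sup>T * selector_mat k r f) $$ (i,j) = 1\<^sub>m r $$ (i,j)"
        using fi I inj by (subst gram) auto
    qed (simp_all add: selector_mat_def)
  qed (simp add: selector_mat_def)
  moreover have "selector_mat k (k - r) g \<in> orthonormal_mats k (k - r)"
  proof (rule orthonormalI)
    show "(selector_mat k (k - r) g)\<^sup>T * selector_mat k (k - r) g = 1\<^sub>m (k - r)"
    proof (rule eq_matI)
      fix i j assume "i < dim_row (1\<^sub>m (k - r) :: real mat)" "j < dim_col (1\<^sub>m (k - r) :: real mat)"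
      then show "((selector_mat k (k - r) g)\<^sup>T * selector_mat k (k - r) g) $$ (i,j) = 1\<^sub>m (k - r) $$ (i,j)"
        using gi injg by (subst gram) auto
    qed (simp_all add: selector_mat_def)
  qed (simp add: selector_mat_def)
  moreover have "(selector_mat k r f)\<^sup>T * selector_mat k (k - r) g = 0\<^sub>m r (k - r)"
  proof (rule eq_matI)
    fix i j assume "i < dim_row (0\<^sub>m r (k - r) :: real mat)" "j < dim_col (0\<^sub>m r (k - r) :: real mat)"
    then have ij: "i < r" "j < k - r" by auto
    then have "f i < k" "f i \<noteq> g j" using fi[OF ij(1)] gi[OF ij(2)] I by auto
    then show "((selector_mat k r f)\<^sup>T * selector_mat k (k - r) g) $$ (i,j) = 0\<^sub>m r (k - r) $$ (i,j)"
      using ij by (subst gram) auto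
  qed (simp_all add: selector_mat_def)
  ultimately show ?thesis unfolding orthonormal_split_def by blast
qed

text \<open>Discarding the zero singular values, while keeping bases of the left and right null
  spaces.\<close>

lemma compact_singular_value_decomposition:
  fixes M :: "real mat"
  assumes M: "M \<in> carrier_mat k k"
  shows "\<exists>r U\<^sub>1 U\<^sub>2 W\<^sub>1 W\<^sub>2 s. r \<le> k \<and> orthonormal_split k k r U\<^sub>1 U\<^sub>2 (1\<^sub>m k) \<and>
    orthonormal_split k k r W\<^sub>1 W\<^sub>2 (1\<^sub>m k) \<and> (\<forall>i<r. 0 < s i) \<and> M = U\<^sub>1 * mat_diag r s * W\<^sub>1\<^sup>T"
proof -
  obtain U W s where U: "U \<in> orthonormal_mats k k" and W: "W \<in> orthonormal_mats k k"
    and s: "\<forall>i. 0 \<le> s i" and diag: "U\<^sup>T * M * W = mat_diag k s"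
    using singular_value_decomposition[OF M] by blast
  define I where "I = {i. i < k \<and> 0 < s i}"
  have I: "I \<subseteq> {..<k}" by (auto simp: I_def)
  then have fin: "finite I" by (rule finite_subset) simp
  define r where "r = card I"
  have r: "r \<le> k" using card_mono[OF _ I] by (simp add: r_def)
  obtain f where f: "bij_betw f {..<r} I"
    using ex_bij_betw_nat_finite[OF fin] by (auto simp: r_def lessThan_atLeast0)
  have "card ({..<k} - I) = k - r" using I fin by (simp add: card_Diff_subset r_def)
  then obtain g where g: "bij_betw g {..<k - r} ({..<k} - I)"
    using ex_bij_betw_nat_finite[of "{..<k} - I"] by (auto simp: lessThan_atLeast0)
  let ?E\<^sub>1 = "selector_mat k r f" and ?E\<^sub>2 = "selector_mat k (k - r) g"
  let ?d = "mat_diag r (\<lambda>j. s (f j))"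
  note E = selector_mat_split[OF f g I]
  note dims = orthonormal_splitD(3-6)[OF E] orthonormal_dim[OF U] orthonormal_dim[OF W]
    carrier_matD[OF M]
  have "mat_diag k s = mat_diag k (\<lambda>i. if i \<in> I then s i else 0)"
    using s by (intro eq_matI) (auto simp: mat_diag_def I_def less_le)
  also have "\<dots> = ?E\<^sub>1 * ?d * ?E\<^sub>1\<^sup>T" by (rule selector_mat_sandwich[OF f, symmetric])
  finally have diag': "mat_diag k s = ?E\<^sub>1 * ?d * ?E\<^sub>1\<^sup>T" .
  have "M = (U * U\<^sup>T) * M * (W * W\<^sup>T)"
    unfolding orthonormal_square_right[OF U] orthonormal_square_right[OF W]
    using dims by (simp add: mat_units)
  also have "\<dots> = U * (U\<^sup>T * M * W) * W\<^sup>T" using dims by (simp add: mat_algebra)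
  also have "\<dots> = U * ?E\<^sub>1 * ?d * (W * ?E\<^sub>1)\<^sup>T"
    unfolding diag diag' using dims by (simp add: mat_algebra mat_diag_dims)
  finally have "M = U * ?E\<^sub>1 * ?d * (W * ?E\<^sub>1)\<^sup>T" .
  moreover have "orthonormal_split k k r (U * ?E\<^sub>1) (U * ?E\<^sub>2) (1\<^sub>m k)"
    using orthonormal_split_mult_left[OF U E] orthonormal_square_right[OF U] by simp
  moreover have "orthonormal_split k k r (W * ?E\<^sub>1) (W * ?E\<^sub>2) (1\<^sub>m k)"
    using orthonormal_split_mult_left[OF W E] orthonormal_square_right[OF W] by simp
  moreover have "\<forall>i<r. 0 < s (f i)" using f by (auto simp: bij_betw_def I_def)
  ultimately show ?thesis
    using r
    by - (rule exI[of _ r], rule exI[of _ "U * ?E\<^sub>1"], rule exI[of _ "U * ?E\<^sub>2"],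
      rule exI[of _ "W * ?E\<^sub>1"], rule exI[of _ "W * ?E\<^sub>2"], rule exI[of _ "\<lambda>j. s (f j)"],
      intro conjI)
qed

text \<open>The reciprocal diagonal matrix and the transposes supply the one-sided inverses required
  by \<open>mat_rank_factorisation\<close>.\<close>

lemma mat_rank_diag_factorisation:
  assumes P: "P \<in> orthonormal_mats m r" and W: "W \<in> orthonormal_mats p r" and s: "\<forall>i<r. s i \<noteq> 0"
  shows "mat_rank (P * mat_diag r s * W\<^sup>T) = r"
proof (rule mat_rank_factorisation)
  note dims = orthonormal_dim[OF P] orthonormal_dim[OF W]
  show "P * mat_diag r s \<in> carrier_mat m r" "mat_diag r (\<lambda>i. 1 / s i) * P\<^sup>T \<in> carrier_mat r m"
    "W\<^sup>T \<in> carrier_mat r p" "W \<in> carrier_mat p r" "W\<^sup>T * W = 1\<^sub>m r"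
    using dims by (auto simp: mat_diag_def orthonormal_gram[OF W])
  have "mat_diag r (\<lambda>i. 1 / s i) * P\<^sup>T * (P * mat_diag r s) = mat_diag r (\<lambda>i. 1 / s i) * mat_diag r s"
    using dims by (simp add: mat_algebra mat_diag_dims orthonormal_cancel[OF P] del: mat_diag_diag)
  also have "\<dots> = 1\<^sub>m r" using s by (rule mat_diag_inverse)
  finally show "mat_diag r (\<lambda>i. 1 / s i) * P\<^sup>T * (P * mat_diag r s) = 1\<^sub>m r" .
qed

corollary mat_rank_orthonormal_mult_transpose:
  assumes "P \<in> orthonormal_mats m r" and "W \<in> orthonormal_mats p r"
  shows "mat_rank (P * W\<^sup>T) = r"
  using mat_rank_diag_factorisation[OF assms, of "\<lambda>_. 1"] assms
  by (simp add: one_mult_dim orthonormal_dim)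

section \<open>Orthonormal bases of a subspace\<close>

text \<open>An orthonormal family in \<open>S\<close> of maximal length spans \<open>S\<close>: otherwise the normalised
  residual of a vector outside its span would extend it.\<close>

lemma ex_orthonormal_basis:
  assumes S: "S \<in> subspaces_of_dim n k"
  shows "\<exists>X \<in> orthonormal_mats n k. mat_range X = S"
proof -
  interpret vec_space "TYPE(real)" n .
  have sub: "submodule class_ring S V"
    and dimS: "vectorspace.dim class_ring (V\<lparr>carrier := S\<rparr>) = k"
    using S by (auto simp: subspaces_of_dim_def VectorSpace.subspace_def)
  have S_carrier: "S \<subseteq> carrier_vec n"
    and S_add: "\<And>v w. v \<in> S \<Longrightarrow> w \<in> S \<Longrightarrow> v + w \<in> S"
    and S_smult: "\<And>c v. v \<in> S \<Longrightarrow> c \<cdot>\<^sub>v v \<in> S"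
    using sub by (auto simp: submodule_def module_vec_simps)
  define Q where "Q us \<longleftrightarrow> set us \<subseteq> S \<and> mat_of_cols n us \<in> orthonormal_mats n (length us)" for us
  have "Q []" by (auto simp: Q_def orthonormal_mats_def intro!: eq_matI)
  moreover have "length us \<le> n" if "Q us" for us
    using that orthonormal_le by (auto simp: Q_def)
  ultimately obtain us where us: "Q us" and max: "\<And>vs. Q vs \<Longrightarrow> length vs \<le> length us"
    using ex_has_greatest_nat[of Q "[]" length "Suc n"] by (auto simp: less_Suc_eq_le)
  define X where "X = mat_of_cols n us"
  let ?j = "length us"
  have X: "X \<in> orthonormal_mats n ?j" and us_S: "set us \<subseteq> S" using us by (simp_all add: Q_def X_def)
  note dimX = orthonormal_dim[OF X]
  have us_carrier: "set us \<subseteq> carrier_vec n" using us_S S_carrier by blast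
  have cols: "cols X = us" unfolding X_def by (rule cols_mat_of_cols[OF us_carrier])
  have range_span: "mat_range X = span (set us)"
    using cols dimX by (simp add: mat_range_def vec_space.col_space_def)
  then have range_sub: "mat_range X \<subseteq> S" using span_is_subset[OF us_S sub] by simp
  have "S \<subseteq> mat_range X"
  proof (rule ccontr)
    assume "\<not> S \<subseteq> mat_range X"
    then obtain v where v: "v \<in> S" "v \<notin> mat_range X" by blast
    have vc: "v \<in> carrier_vec n" using v S_carrier by blast
    define y where "y = X *\<^sub>v (X\<^sup>T *\<^sub>v v)"
    have XTv: "X\<^sup>T *\<^sub>v v \<in> carrier_vec ?j" using dimX by (intro carrier_vecI) simp
    then have y: "y \<in> mat_range X"
      unfolding mat_range_eq_image[OF orthonormal_carrier[OF X]] y_def by blast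
    have yc: "y \<in> carrier_vec n" using y range_sub S_carrier by blast
    define w where "w = v + (-1) \<cdot>\<^sub>v y"
    have wS: "w \<in> S" using v y range_sub S_add S_smult by (auto simp: w_def)
    have wc: "w \<in> carrier_vec n" using wS S_carrier by blast
    have w0: "w \<noteq> 0\<^sub>v n"
    proof
      assume w0: "w = 0\<^sub>v n"
      have "v = y"
      proof (rule eq_vecI)
        fix i assume "i < dim_vec y"
        then have "i < n" using yc by simp
        moreover have "w $ i = (0\<^sub>v n :: real vec) $ i" by (simp add: w0)
        ultimately show "v $ i = y $ i" using vc yc by (simp add: w_def)
      qed (use vc yc in simp)
      with v y show False by simp
    qed
    have orth: "us ! i \<bullet> w = 0" if i: "i < ?j" for i
    proof -
      have col: "col X i = us ! i" using cols i dimX by (metis cols_nth)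
      have ci: "us ! i \<in> carrier_vec n" using us_carrier i by auto
      have "us ! i \<bullet> y = (X\<^sup>T *\<^sub>v y) $ i" using i dimX col by simp
      also have "X\<^sup>T *\<^sub>v y = X\<^sup>T *\<^sub>v v"
      proof -
        have "X\<^sup>T *\<^sub>v y = (X\<^sup>T * X) *\<^sub>v (X\<^sup>T *\<^sub>v v)"
          unfolding y_def using dimX by (simp add: mult_mat_vec_assoc_dim)
        then show ?thesis using XTv by (simp add: orthonormal_gram[OF X])
      qed
      also have "(X\<^sup>T *\<^sub>v v) $ i = us ! i \<bullet> v" using i dimX col by simp
      finally show ?thesis
        using ci vc yc by (simp add: w_def scalar_prod_add_distrib[of _ n])
    qed
    obtain c where c: "(c \<cdot>\<^sub>v w) \<bullet> (c \<cdot>\<^sub>v w) = 1" using ex_unit_multiple[OF wc w0] by blast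
    define u where "u = c \<cdot>\<^sub>v w"
    have uc: "u \<in> carrier_vec n" using wc by (simp add: u_def)
    have orth_u: "us ! i \<bullet> u = 0" "u \<bullet> us ! i = 0" if i: "i < ?j" for i
    proof -
      have ci: "us ! i \<in> carrier_vec n" using us_carrier i by auto
      show "us ! i \<bullet> u = 0" using ci wc orth[OF i] by (simp add: u_def)
      then show "u \<bullet> us ! i = 0" using comm_scalar_prod[OF ci uc] by simp
    qed
    have orth_us: "us ! i \<bullet> us ! l = (if i = l then 1 else 0)" if "i < ?j" "l < ?j" for i l
      using orthonormal_col_scalar_prod[OF X that] cols that dimX by (metis cols_nth)
    have "Q (us @ [u])"
      unfolding Q_def
    proof
      show "set (us @ [u]) \<subseteq> S" using us_S S_smult[OF wS] by (simp add: u_def)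
      show "mat_of_cols n (us @ [u]) \<in> orthonormal_mats n (length (us @ [u]))"
      proof (rule orthonormalI_cols)
        fix i l assume il: "i < length (us @ [u])" "l < length (us @ [u])"
        have "col (mat_of_cols n (us @ [u])) i = (us @ [u]) ! i"
          if "i < length (us @ [u])" for i
          by (rule col_mat_of_cols[OF that]) (use that us_carrier uc in \<open>auto simp: nth_append\<close>)
        then show "col (mat_of_cols n (us @ [u])) i \<bullet> col (mat_of_cols n (us @ [u])) l
            = (if i = l then 1 else 0)"
          using il c orth_u orth_us by (auto simp: nth_append less_Suc_eq u_def[symmetric])
      qed (rule mat_of_cols_carrier)
    qed
    from max[OF this] show False by simp
  qed
  with range_sub have range: "mat_range X = S" by blast
  have "k = mat_rank X"
    using dimS cols range range_span dimX by (simp add: mat_rank_def vec_space.rank_def)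
  also have "\<dots> = ?j"
    using mat_rank_left_inverse(1)[of X n ?j "X\<^sup>T"] X by (simp add: orthonormal_mats_def)
  finally show ?thesis using X range by blast
qed

section \<open>The traces in the objective\<close>

text \<open>Otherwise the quadratic form, which vanishes at \<open>v\<close> and has gradient \<open>2 B v\<close> there, would
  take negative values on the line through \<open>v\<close> with direction \<open>B v\<close>.\<close>

lemma pos_semidef_kernel:
  assumes B: "B \<in> carrier_mat n n" and psd: "pos_semidef B"
    and v: "v \<in> carrier_vec n" and vBv: "v \<bullet> (B *\<^sub>v v) = 0"
  shows "B *\<^sub>v v = 0\<^sub>v n"
proof -
  define w where "w = B *\<^sub>v v"
  have w: "w \<in> carrier_vec n" using B v by (simp add: w_def)
  have sym: "B\<^sup>T = B" using psd by (simp add: pos_semidef_def symmetric_matrix_def)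
  have Bw: "B *\<^sub>v w \<in> carrier_vec n" using B w by simp
  have nonneg: "0 \<le> x \<bullet> (B *\<^sub>v x)" if "x \<in> carrier_vec n" for x
    using psd B that by (auto simp: pos_semidef_def)
  have vBw: "v \<bullet> (B *\<^sub>v w) = w \<bullet> w"
    using transpose_vec_mult_scalar[OF B w v] by (simp add: sym w_def)
  define c d where "c = w \<bullet> w" and "d = w \<bullet> (B *\<^sub>v w)"
  have d: "0 \<le> d" using nonneg[OF w] by (simp add: d_def)
  have quad: "0 \<le> 2 * t * c + t * t * d" for t
  proof -
    have tw: "t \<cdot>\<^sub>v w \<in> carrier_vec n" using w by simp
    have "0 \<le> (v + t \<cdot>\<^sub>v w) \<bullet> (B *\<^sub>v (v + t \<cdot>\<^sub>v w))" using v tw by (intro nonneg) simp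
    also have "B *\<^sub>v (v + t \<cdot>\<^sub>v w) = w + t \<cdot>\<^sub>v (B *\<^sub>v w)"
      using mult_add_distrib_mat_vec[OF B v tw] mult_mat_vec[OF B w] by (simp add: w_def)
    also have "(v + t \<cdot>\<^sub>v w) \<bullet> \<dots> = (v \<bullet> w + t * (v \<bullet> (B *\<^sub>v w))) + t * (w \<bullet> w + t * (w \<bullet> (B *\<^sub>v w)))"
      using v w Bw by (simp add: add_scalar_prod_distrib[of _ n] scalar_prod_add_distrib[of _ n] distrib_left)
    finally show ?thesis
      using vBv by (simp add: vBw c_def d_def algebra_simps flip: w_def)
  qed
  have "c = 0"
  proof (rule ccontr)
    assume "c \<noteq> 0"
    then have c: "0 < c" using scalar_prod_self_nonneg[of w] by (simp add: c_def)
    (* The minimizer is - c / d; the denominator d + 1 also covers the case d = 0. *)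
    have "0 \<le> (- c / (d + 1)) * (2 * c + (- c / (d + 1)) * d)"
      using quad[of "- c / (d + 1)"] by (simp add: algebra_simps)
    moreover have "2 * c + (- c / (d + 1)) * d > 0" using c d by (simp add: field_simps add_nonneg_pos)
    moreover have "- c / (d + 1) < 0" using c d by (simp add: field_simps)
    ultimately show False by (meson mult_neg_pos not_le)
  qed
  then show ?thesis
    using scalar_prod_self_eq_0[of w] carrier_vecD[OF w] by (simp add: c_def flip: w_def)
qed

text \<open>If the trace vanished, the \<open>k\<close> orthonormal columns of \<open>X\<close> would lie in the kernel of
  \<open>B\<close>, which has dimension \<open>n - rank B < k\<close>.\<close>

lemma trace_pos_semidef_pos:
  assumes B: "B \<in> carrier_mat n n" and psd: "pos_semidef B"
    and rank: "n - k < mat_rank B" and X: "X \<in> orthonormal_mats n k"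
  shows "0 < mat_trace (X\<^sup>T * B * X)"
proof -
  note dimX = orthonormal_dim[OF X] and dimB = carrier_matD[OF B]
  have col: "col X j \<in> carrier_vec n" for j using dimX by (intro carrier_vecI) simp
  have trace: "mat_trace (X\<^sup>T * B * X) = (\<Sum>j<k. col X j \<bullet> (B *\<^sub>v col X j))"
    using dimX dimB by (simp add: mat_trace_def mult_assoc_dim col_mult_dim)
  have nonneg: "0 \<le> col X j \<bullet> (B *\<^sub>v col X j)" for j
    using psd col[of j] dimB by (auto simp: pos_semidef_def)
  have "mat_trace (X\<^sup>T * B * X) \<noteq> 0"
  proof
    assume "mat_trace (X\<^sup>T * B * X) = 0"
    then have "\<forall>j<k. col X j \<bullet> (B *\<^sub>v col X j) = 0"
      unfolding trace by (subst (asm) sum_nonneg_eq_0_iff) (auto simp: nonneg)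
    then have ker: "B *\<^sub>v col X j = 0\<^sub>v n" if "j < k" for j
      using that by (intro pos_semidef_kernel[OF B psd col]) simp
    have BX: "B * X = 0\<^sub>m n k"
      by (rule mat_col_eqI) (use dimX dimB in \<open>auto simp: col_mult_dim ker\<close>)
    obtain r U\<^sub>1 U\<^sub>2 W\<^sub>1 W\<^sub>2 s where r: "r \<le> n"
      and U: "orthonormal_split n n r U\<^sub>1 U\<^sub>2 (1\<^sub>m n)" and W: "orthonormal_split n n r W\<^sub>1 W\<^sub>2 (1\<^sub>m n)"
      and s: "\<forall>i<r. 0 < s i" and svd: "B = U\<^sub>1 * mat_diag r s * W\<^sub>1\<^sup>T"
      using compact_singular_value_decomposition[OF B] by metis
    note DU = orthonormal_splitD[OF U] and DW = orthonormal_splitD[OF W]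
    note dims = DU(3-6) DW(3-6) dimX
    have s0: "\<forall>i<r. s i \<noteq> 0" using s by (metis less_irrefl)
    have rank_B: "mat_rank B = r"
      unfolding svd by (rule mat_rank_diag_factorisation[OF DU(1) DW(1) s0])
    have inv: "mat_diag r (\<lambda>i. 1 / s i) * mat_diag r s = 1\<^sub>m r"
      using s0 by (rule mat_diag_inverse)
    have "W\<^sub>1\<^sup>T * X = (mat_diag r (\<lambda>i. 1 / s i) * mat_diag r s) * (W\<^sub>1\<^sup>T * X)"
      unfolding inv using dims by (simp add: mat_units)
    also have "\<dots> = mat_diag r (\<lambda>i. 1 / s i) * (U\<^sub>1\<^sup>T * (B * X))"
      unfolding svd using dims
      by (simp add: mat_algebra mat_diag_dims orthonormal_split_cancel[OF U] del: mat_diag_diag)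
    also have "\<dots> = 0\<^sub>m r k"
      unfolding BX using dims by (simp add: mat_units mat_diag_dims)
    finally have W\<^sub>1X: "W\<^sub>1\<^sup>T * X = 0\<^sub>m r k" .
    have "W\<^sub>2\<^sup>T * X \<in> orthonormal_mats (n - r) k"
    proof (rule orthonormalI)
      show "W\<^sub>2\<^sup>T * X \<in> carrier_mat (n - r) k" using dims by auto
      have "X\<^sup>T * X = X\<^sup>T * ((W\<^sub>1 * W\<^sub>1\<^sup>T + W\<^sub>2 * W\<^sub>2\<^sup>T) * X)"
        unfolding DW(11) using dims by (simp add: mat_units)
      also have "\<dots> = (W\<^sub>2\<^sup>T * X)\<^sup>T * (W\<^sub>2\<^sup>T * X)"
        using dims by (simp add: mat_algebra W\<^sub>1X mat_units)
      finally show "(W\<^sub>2\<^sup>T * X)\<^sup>T * (W\<^sub>2\<^sup>T * X) = 1\<^sub>m k" by (simp add: orthonormal_gram[OF X])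
    qed
    then have "k \<le> n - r" by (rule orthonormal_le)
    with rank r show False by (simp add: rank_B)
  qed
  moreover have "0 \<le> mat_trace (X\<^sup>T * B * X)" unfolding trace by (intro sum_nonneg nonneg)
  ultimately show ?thesis by simp
qed

text \<open>The trace is \<open>\<Sum>i<r. s i * (y\<^sub>i \<bullet> p\<^sub>i)\<close> for the columns \<open>y\<^sub>i\<close>, \<open>p\<^sub>i\<close>, and
  \<open>y\<^sub>i \<bullet> p\<^sub>i = 1 - \<bar>y\<^sub>i - p\<^sub>i\<bar>\<^sup>2 / 2\<close> for unit vectors.\<close>

lemma trace_orthonormal_le:
  assumes Y: "Y \<in> orthonormal_mats n r" and P: "P \<in> orthonormal_mats n r" and s: "\<forall>i<r. 0 < s i"
  shows "mat_trace (Y\<^sup>T * P * mat_diag r s) \<le> (\<Sum>i<r. s i)"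
    and "mat_trace (Y\<^sup>T * P * mat_diag r s) = (\<Sum>i<r. s i) \<longleftrightarrow> Y = P"
proof -
  note dims = orthonormal_dim[OF Y] orthonormal_dim[OF P]
  define e where "e i = (col Y i - col P i) \<bullet> (col Y i - col P i)" for i
  have e0: "0 \<le> e i" for i unfolding e_def by (rule scalar_prod_self_nonneg)
  have dot: "col Y i \<bullet> col P i = 1 - e i / 2" if i: "i < r" for i
  proof -
    have c: "col Y i \<in> carrier_vec n" "col P i \<in> carrier_vec n" using dims by (auto intro!: carrier_vecI)
    have "e i = (col Y i \<bullet> col Y i - col P i \<bullet> col Y i) - (col Y i \<bullet> col P i - col P i \<bullet> col P i)"
      unfolding e_def using c
      by (simp add: minus_scalar_prod_distrib[of _ n] scalar_prod_minus_distrib[of _ n])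
    then show ?thesis
      using orthonormal_col_scalar_prod[OF Y i i] orthonormal_col_scalar_prod[OF P i i]
        comm_scalar_prod[OF c] by (simp add: field_simps)
  qed
  have "mat_trace (Y\<^sup>T * P * mat_diag r s) = (\<Sum>i<r. (Y\<^sup>T * P) $$ (i,i) * s i)"
    using dims by (subst mat_diag_mult_right[of _ r]) (auto simp: mat_trace_def)
  also have "\<dots> = (\<Sum>i<r. s i - s i * e i / 2)"
    using dims by (intro sum.cong) (auto simp: dot algebra_simps)
  finally have tr: "mat_trace (Y\<^sup>T * P * mat_diag r s) = (\<Sum>i<r. s i) - (\<Sum>i<r. s i * e i / 2)"
    by (simp add: sum_subtractf)
  have nonneg: "0 \<le> s i * e i / 2" if "i < r" for i using s e0 that by (simp add: less_imp_le)
  show "mat_trace (Y\<^sup>T * P * mat_diag r s) \<le> (\<Sum>i<r. s i)"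
    unfolding tr using sum_nonneg[of "{..<r}" "\<lambda>i. s i * e i / 2"] nonneg by simp
  have "mat_trace (Y\<^sup>T * P * mat_diag r s) = (\<Sum>i<r. s i) \<longleftrightarrow> (\<forall>i<r. s i * e i / 2 = 0)"
    unfolding tr using sum_nonneg_eq_0_iff[of "{..<r}" "\<lambda>i. s i * e i / 2"] nonneg by auto
  also have "\<dots> \<longleftrightarrow> (\<forall>i<r. e i = 0)"
    using s by (metis div_0 divide_eq_0_iff less_irrefl mult_eq_0_iff zero_neq_numeral)
  also have "\<dots> \<longleftrightarrow> Y = P"
  proof
    assume *: "\<forall>i<r. e i = 0"
    show "Y = P"
    proof (rule eq_matI)
      fix l i assume "l < dim_row P" "i < dim_col P"
      then have li: "l < n" "i < r" using dims by auto
      have "col Y i - col P i = 0\<^sub>v n"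
        using * li dims scalar_prod_self_eq_0[of "col Y i - col P i"] by (simp add: e_def)
      then have "(col Y i - col P i) $ l = 0" using li by simp
      then show "Y $$ (l,i) = P $$ (l,i)" using li dims by simp
    qed (use dims in auto)
  next
    assume "Y = P"
    then show "\<forall>i<r. e i = 0" using dims by (auto simp: e_def scalar_prod_self_eq_0 intro!: eq_vecI)
  qed
  finally show "mat_trace (Y\<^sup>T * P * mat_diag r s) = (\<Sum>i<r. s i) \<longleftrightarrow> Y = P" .
qed

section \<open>The maximizers over a fixed column space\<close>

text \<open>A matrix with orthonormal columns and range projector \<open>Pr\<close> that sends \<open>W\<^sub>1\<close> to \<open>P\<^sub>1\<close>
  must send the orthogonal complement of \<open>W\<^sub>1\<close> to that of \<open>P\<^sub>1\<close> within the range; the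
  orthogonal matrix \<open>Q\<close> is this map in the coordinates given by \<open>W\<^sub>2\<close> and \<open>P\<^sub>2\<close>.\<close>

lemma bij_betw_orthonormal_completions:
  assumes P: "orthonormal_split n k r P\<^sub>1 P\<^sub>2 Pr" and W: "orthonormal_split k k r W\<^sub>1 W\<^sub>2 (1\<^sub>m k)"
  shows "bij_betw (\<lambda>Q. P\<^sub>1 * W\<^sub>1\<^sup>T + P\<^sub>2 * Q * W\<^sub>2\<^sup>T) (orthonormal_mats (k - r) (k - r))
    {X \<in> orthonormal_mats n k. X * X\<^sup>T = Pr \<and> X * W\<^sub>1 = P\<^sub>1}"
    (is "bij_betw ?f ?O ?M")
proof -
  note DP = orthonormal_splitD[OF P] and DW = orthonormal_splitD[OF W]
  note dims = DP(3-6) DW(3-6)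
  note cancel = orthonormal_split_cancel[OF P] orthonormal_split_cancel[OF W] DP(7-10) DW(7-10)
  let ?g = "\<lambda>X. P\<^sub>2\<^sup>T * X * W\<^sub>2"
  have gf: "?g (?f Q) = Q" if "Q \<in> ?O" for Q
    using dims orthonormal_dim[OF that] by (simp add: mat_algebra cancel mat_units)
  have fO: "?f Q \<in> ?M" if Q: "Q \<in> ?O" for Q
  proof -
    note dQ = orthonormal_dim[OF Q]
    have "(?f Q)\<^sup>T = W\<^sub>1 * P\<^sub>1\<^sup>T + W\<^sub>2 * (Q\<^sup>T * P\<^sub>2\<^sup>T)"
      using dims dQ by (subst transpose_add[of _ n k]) (auto simp: mat_algebra)
    moreover have "(W\<^sub>1 * P\<^sub>1\<^sup>T + W\<^sub>2 * (Q\<^sup>T * P\<^sub>2\<^sup>T)) * ?f Q = W\<^sub>1 * W\<^sub>1\<^sup>T + W\<^sub>2 * W\<^sub>2\<^sup>T"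
      using dims dQ by (simp add: mat_algebra cancel mat_units orthonormal_cancel[OF Q])
    moreover have "?f Q * (W\<^sub>1 * P\<^sub>1\<^sup>T + W\<^sub>2 * (Q\<^sup>T * P\<^sub>2\<^sup>T)) = P\<^sub>1 * P\<^sub>1\<^sup>T + P\<^sub>2 * (Q * Q\<^sup>T * P\<^sub>2\<^sup>T)"
      using dims dQ by (simp add: mat_algebra cancel mat_units)
    moreover have "Q * Q\<^sup>T * P\<^sub>2\<^sup>T = P\<^sub>2\<^sup>T"
      unfolding orthonormal_square_right[OF Q] using dims by (simp add: mat_units)
    ultimately have "(?f Q)\<^sup>T * ?f Q = 1\<^sub>m k" "?f Q * (?f Q)\<^sup>T = Pr"
      by (simp_all only: DW(11) DP(11))
    moreover have "?f Q \<in> carrier_mat n k" using dims dQ by auto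
    moreover have "?f Q * W\<^sub>1 = P\<^sub>1"
      using dims dQ by (simp add: mat_algebra cancel mat_units)
    ultimately show ?thesis by (simp add: orthonormal_mats_def)
  qed
  have X_facts: "P\<^sub>2 * (P\<^sub>2\<^sup>T * (X * W\<^sub>2)) = X * W\<^sub>2"
    if X: "X \<in> orthonormal_mats n k" "X * X\<^sup>T = Pr" "X * W\<^sub>1 = P\<^sub>1" for X
  proof -
    note dX = orthonormal_dim[OF X(1)]
    have "P\<^sub>1\<^sup>T * (X * W\<^sub>2) = W\<^sub>1\<^sup>T * (X\<^sup>T * (X * W\<^sub>2))"
      using dims dX by (simp add: mat_algebra flip: X(3))
    also have "\<dots> = 0\<^sub>m r (k - r)" using dims by (simp add: orthonormal_cancel[OF X(1)] cancel)
    finally have 0: "P\<^sub>1\<^sup>T * (X * W\<^sub>2) = 0\<^sub>m r (k - r)" .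
    have "X * W\<^sub>2 = X * X\<^sup>T * (X * W\<^sub>2)"
      using dims dX by (simp add: mult_assoc_dim orthonormal_cancel[OF X(1)])
    also have "\<dots> = (P\<^sub>1 * P\<^sub>1\<^sup>T + P\<^sub>2 * P\<^sub>2\<^sup>T) * (X * W\<^sub>2)" by (simp only: X(2) DP(11))
    also have "\<dots> = P\<^sub>2 * (P\<^sub>2\<^sup>T * (X * W\<^sub>2))"
      using dims dX by (simp add: mat_algebra 0 mat_units)
    finally show ?thesis ..
  qed
  have fg: "?f (?g X) = X" if "X \<in> ?M" for X
  proof -
    have X: "X \<in> orthonormal_mats n k" "X * X\<^sup>T = Pr" "X * W\<^sub>1 = P\<^sub>1" using that by auto
    note dX = orthonormal_dim[OF X(1)]
    have "?f (?g X) = P\<^sub>1 * W\<^sub>1\<^sup>T + P\<^sub>2 * (P\<^sub>2\<^sup>T * (X * W\<^sub>2)) * W\<^sub>2\<^sup>T"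
      using dims dX by (simp add: mat_algebra)
    also have "\<dots> = X * W\<^sub>1 * W\<^sub>1\<^sup>T + X * W\<^sub>2 * W\<^sub>2\<^sup>T" by (simp only: X_facts[OF X] X(3))
    also have "\<dots> = X * (W\<^sub>1 * W\<^sub>1\<^sup>T + W\<^sub>2 * W\<^sub>2\<^sup>T)" using dims dX by (simp add: mat_algebra)
    also have "\<dots> = X" unfolding DW(11) using dX by (simp add: mat_units)
    finally show ?thesis .
  qed
  have gM: "?g X \<in> ?O" if "X \<in> ?M" for X
  proof (rule orthonormalI)
    have X: "X \<in> orthonormal_mats n k" "X * X\<^sup>T = Pr" "X * W\<^sub>1 = P\<^sub>1" using that by auto
    note dX = orthonormal_dim[OF X(1)]
    show "?g X \<in> carrier_mat (k - r) (k - r)" using dims dX by auto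
    have "(?g X)\<^sup>T * ?g X = W\<^sub>2\<^sup>T * (X\<^sup>T * (P\<^sub>2 * (P\<^sub>2\<^sup>T * (X * W\<^sub>2))))"
      using dims dX by (simp add: mat_algebra)
    also have "\<dots> = 1\<^sub>m (k - r)"
      unfolding X_facts[OF X] using dims by (simp add: orthonormal_cancel[OF X(1)] cancel)
    finally show "(?g X)\<^sup>T * ?g X = 1\<^sub>m (k - r)" .
  qed
  show ?thesis
    by (rule bij_betw_byWitness[where f' = ?g]) (use gf fO fg gM in blast)+
qed

lemma is_arg_max_iff_bound_attained:
  fixes f :: "'a \<Rightarrow> 'b :: linorder"
  assumes "\<And>x. P x \<Longrightarrow> f x \<le> c" and "P x\<^sub>0" and "f x\<^sub>0 = c"
  shows "is_arg_max f P x \<longleftrightarrow> P x \<and> f x = c"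
  using assms unfolding is_arg_max_def by (metis leD le_less)

text \<open>On the feasible set only the term with \<open>D\<close> varies. With the compact singular value
  decomposition \<open>X\<^sub>0\<^sup>T D = U\<^sub>1 \<Sigma> W\<^sub>1\<^sup>T\<close> and \<open>P\<^sub>1 = X\<^sub>0 U\<^sub>1\<close> it is
  \<open>trace ((X W\<^sub>1)\<^sup>T P\<^sub>1 \<Sigma>)\<close>, which is largest exactly when \<open>X W\<^sub>1 = P\<^sub>1\<close>.\<close>

lemma maximizers_parametrisation:
  assumes A: "A \<in> carrier_mat n n"
    and B: "B \<in> carrier_mat n n" and psd: "pos_semidef B" and rank: "n - k < mat_rank B"
    and D: "D \<in> carrier_mat n k"
    and S: "S \<in> subspaces_of_dim n k" and r: "r = rank_D n k D S"
  shows "\<exists>Z. Z \<in> carrier_mat n k \<and> mat_rank Z = r \<and>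
    (\<exists>P \<in> orthonormal_mats n (k - r). \<exists>W \<in> orthonormal_mats k (k - r).
       bij_betw (\<lambda>Q. Z + P * Q * W\<^sup>T)
         (orthonormal_mats (k - r) (k - r)) (maximizers n k A B D \<theta> S) \<and>
       (\<forall>Q \<in> orthonormal_mats (k - r) (k - r). mat_rank (P * Q * W\<^sup>T) = k - r))"
proof -
  obtain X\<^sub>0 where X\<^sub>0: "X\<^sub>0 \<in> orthonormal_mats n k" and range: "mat_range X\<^sub>0 = S"
    using ex_orthonormal_basis[OF S] by blast
  note dX\<^sub>0 = orthonormal_dim[OF X\<^sub>0] and dA = carrier_matD[OF A] and dB = carrier_matD[OF B]
    and dD = carrier_matD[OF D]
  define Pr where "Pr = X\<^sub>0 * X\<^sub>0\<^sup>T"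
  have "X\<^sub>0\<^sup>T * D \<in> carrier_mat k k" using dX\<^sub>0 dD by auto
  from compact_singular_value_decomposition[OF this]
  obtain p U\<^sub>1 U\<^sub>2 W\<^sub>1 W\<^sub>2 s where U: "orthonormal_split k k p U\<^sub>1 U\<^sub>2 (1\<^sub>m k)"
    and W: "orthonormal_split k k p W\<^sub>1 W\<^sub>2 (1\<^sub>m k)"
    and s: "\<forall>i<p. 0 < s i" and svd: "X\<^sub>0\<^sup>T * D = U\<^sub>1 * mat_diag p s * W\<^sub>1\<^sup>T" by blast
  define P\<^sub>1 where "P\<^sub>1 = X\<^sub>0 * U\<^sub>1"
  define P\<^sub>2 where "P\<^sub>2 = X\<^sub>0 * U\<^sub>2"
  have P: "orthonormal_split n k p P\<^sub>1 P\<^sub>2 Pr"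
    using orthonormal_split_mult_left[OF X\<^sub>0 U] by (simp add: P\<^sub>1_def P\<^sub>2_def Pr_def)
  note DP = orthonormal_splitD[OF P] and DW = orthonormal_splitD[OF W] and DU = orthonormal_splitD[OF U]
  note dims = DP(3-6) DW(3-6) DU(3-6) dX\<^sub>0
  define F where "F X \<longleftrightarrow> X \<in> orthonormal_mats n k \<and> mat_range X = S" for X
  have F_iff: "F X \<longleftrightarrow> X \<in> orthonormal_mats n k \<and> X * X\<^sup>T = Pr" for X
    using mat_range_eq_iff_projector_eq[OF _ X\<^sub>0, of X] by (auto simp: F_def range Pr_def)
  have XP: "X * (X\<^sup>T * P\<^sub>1) = P\<^sub>1" if "F X" for X
  proof -
    note X = that[unfolded F_iff, THEN conjunct1] that[unfolded F_iff, THEN conjunct2]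
    have "X * (X\<^sup>T * P\<^sub>1) = Pr * P\<^sub>1"
      using orthonormal_dim[OF X(1)] dims by (simp add: mult_assoc_dim flip: X(2))
    also have "\<dots> = P\<^sub>1"
      using dims by (simp add: Pr_def P\<^sub>1_def mult_assoc_dim orthonormal_cancel[OF X\<^sub>0])
    finally show ?thesis .
  qed
  have XD: "X\<^sup>T * D = X\<^sup>T * P\<^sub>1 * mat_diag p s * W\<^sub>1\<^sup>T" if "F X" for X
  proof -
    note X = that[unfolded F_iff, THEN conjunct1] that[unfolded F_iff, THEN conjunct2]
    note dX = orthonormal_dim[OF X(1)]
    have "X\<^sup>T * D = X\<^sup>T * (X * X\<^sup>T) * D"
      using dX dD by (simp add: mult_assoc_dim orthonormal_cancel[OF X(1)])
    also have "\<dots> = X\<^sup>T * X\<^sub>0 * (X\<^sub>0\<^sup>T * D)"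
      unfolding X(2) Pr_def using dX dD dims by (simp add: mult_assoc_dim)
    also have "\<dots> = X\<^sup>T * P\<^sub>1 * mat_diag p s * W\<^sub>1\<^sup>T"
      unfolding svd P\<^sub>1_def using dX dims by (simp add: mult_assoc_dim mat_diag_dims)
    finally show ?thesis .
  qed
  have s0: "\<forall>i<p. s i \<noteq> 0" using s by (metis less_irrefl)
  have rank_XD: "mat_rank (X\<^sup>T * D) = p" if "F X" for X
    unfolding XD[OF that]
  proof (rule mat_rank_diag_factorisation[OF _ DW(1) s0])
    note X = that[unfolded F_iff, THEN conjunct1]
    note dX = orthonormal_dim[OF X]
    show "X\<^sup>T * P\<^sub>1 \<in> orthonormal_mats k p"
      using dX dims DP(7) by (intro orthonormalI) (auto simp: mat_algebra XP[OF that])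
  qed
  have F\<^sub>0: "F X\<^sub>0" by (simp add: F_def X\<^sub>0 range)
  have "rank_D n k D S = p"
    unfolding rank_D_def
    by (rule the_equality) (use rank_XD F\<^sub>0 in \<open>auto simp: F_def\<close>)
  then have rp: "r = p" by (simp add: r)
  define b where "b = mat_trace (X\<^sub>0\<^sup>T * B * X\<^sub>0) powr \<theta>"
  have b: "0 < b"
    using trace_pos_semidef_pos[OF B psd rank X\<^sub>0] by (simp add: b_def)
  have trace_const: "mat_trace (X\<^sup>T * C * X) = mat_trace (X\<^sub>0\<^sup>T * C * X\<^sub>0)"
    if C: "C \<in> carrier_mat n n" and X: "F X" for C X
  proof -
    have *: "mat_trace (X\<^sup>T * C * X) = mat_trace (C * Pr)" if "F X" for X
    proof -
      note X = that[unfolded F_iff, THEN conjunct1] that[unfolded F_iff, THEN conjunct2]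
      note dX = orthonormal_dim[OF X(1)] and dC = carrier_matD[OF C]
      have "mat_trace (X\<^sup>T * (C * X)) = mat_trace (C * X * X\<^sup>T)"
        using dX dC by (intro mat_trace_mult_commute[of _ k n]) auto
      then show ?thesis using dX dC by (simp add: mult_assoc_dim X(2))
    qed
    show ?thesis using *[OF X] *[OF F\<^sub>0] by simp
  qed
  define a where "a = mat_trace (X\<^sub>0\<^sup>T * A * X\<^sub>0)"
  have objective: "f_theta A B D \<theta> X = (a + mat_trace ((X * W\<^sub>1)\<^sup>T * P\<^sub>1 * mat_diag p s)) / b"
    if "F X" for X
  proof -
    note X = that[unfolded F_iff, THEN conjunct1]
    note dX = orthonormal_dim[OF X]
    have "mat_trace (X\<^sup>T * D) = mat_trace (W\<^sub>1\<^sup>T * (X\<^sup>T * P\<^sub>1 * mat_diag p s))"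
      unfolding XD[OF that] using dX dims
      by (intro mat_trace_mult_commute[of _ k p]) (auto simp: mat_diag_dims)
    also have "W\<^sub>1\<^sup>T * (X\<^sup>T * P\<^sub>1 * mat_diag p s) = (X * W\<^sub>1)\<^sup>T * P\<^sub>1 * mat_diag p s"
      using dX dims by (simp add: mat_algebra mat_diag_dims)
    finally have tr_D: "mat_trace (X\<^sup>T * D) = mat_trace ((X * W\<^sub>1)\<^sup>T * P\<^sub>1 * mat_diag p s)" .
    have "mat_trace (X\<^sup>T * A * X + X\<^sup>T * D) = mat_trace (X\<^sup>T * A * X) + mat_trace (X\<^sup>T * D)"
      using dX dA dD by (intro mat_trace_add[of _ k]) auto
    then show ?thesis
      unfolding f_theta_def trace_const[OF B that] b_def
      by (simp only: tr_D trace_const[OF A that] a_def)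
  qed
  let ?max = "(a + (\<Sum>i<p. s i)) / b"
  have bound: "f_theta A B D \<theta> X \<le> ?max" "f_theta A B D \<theta> X = ?max \<longleftrightarrow> X * W\<^sub>1 = P\<^sub>1"
    if X: "F X" for X
  proof -
    have XW: "X * W\<^sub>1 \<in> orthonormal_mats n p"
      using X DW(1) by (auto simp: F_iff intro: orthonormal_mult)
    show "f_theta A B D \<theta> X \<le> ?max"
      unfolding objective[OF X] using b trace_orthonormal_le(1)[OF XW DP(1) s]
      by (simp add: divide_right_mono)
    show "f_theta A B D \<theta> X = ?max \<longleftrightarrow> X * W\<^sub>1 = P\<^sub>1"
      unfolding objective[OF X] using b trace_orthonormal_le(2)[OF XW DP(1) s] by simp
  qed
  let ?M = "{X \<in> orthonormal_mats n k. X * X\<^sup>T = Pr \<and> X * W\<^sub>1 = P\<^sub>1}"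
  have bij: "bij_betw (\<lambda>Q. P\<^sub>1 * W\<^sub>1\<^sup>T + P\<^sub>2 * Q * W\<^sub>2\<^sup>T) (orthonormal_mats (k - p) (k - p)) ?M"
    by (rule bij_betw_orthonormal_completions[OF P W])
  have "1\<^sub>m (k - p) \<in> orthonormal_mats (k - p) (k - p)" by (simp add: orthonormal_mats_def)
  then have "?M \<noteq> {}" using bij by (auto simp: bij_betw_def)
  then obtain Y where Y: "F Y" "Y * W\<^sub>1 = P\<^sub>1" by (auto simp: F_iff)
  have "is_arg_max (f_theta A B D \<theta>) F X \<longleftrightarrow> F X \<and> f_theta A B D \<theta> X = ?max" for X
    by (rule is_arg_max_iff_bound_attained[where P = F and x\<^sub>0 = Y]) (use Y bound in auto)
  then have "maximizers n k A B D \<theta> S = {X. F X \<and> f_theta A B D \<theta> X = ?max}"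
    by (simp add: maximizers_def F_def[abs_def])
  also have "\<dots> = ?M" using bound(2) by (auto simp: F_iff)
  finally have maximizers: "maximizers n k A B D \<theta> S = ?M" .
  have "mat_rank (P\<^sub>2 * Q * W\<^sub>2\<^sup>T) = k - p" if "Q \<in> orthonormal_mats (k - p) (k - p)" for Q
    by (rule mat_rank_orthonormal_mult_transpose[OF orthonormal_mult[OF DP(2) that] DW(2)])
  moreover have "mat_rank (P\<^sub>1 * W\<^sub>1\<^sup>T) = p"
    by (rule mat_rank_orthonormal_mult_transpose[OF DP(1) DW(1)])
  moreover have "P\<^sub>1 * W\<^sub>1\<^sup>T \<in> carrier_mat n k" using dims by auto
  ultimately show ?thesis
    unfolding rp maximizers using bij DP(2) DW(2) by blast
qed

theorem theorem3p1:
  fixes n k :: nat and A B D :: "real mat" and \<theta> :: real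
  assumes "1 \<le> k" and "k < n"
    and "A \<in> carrier_mat n n" and "symmetric_matrix A"
    and "B \<in> carrier_mat n n" and "pos_semidef B" and "n - k < mat_rank B"
    and "D \<in> carrier_mat n k"
    and "0 \<le> \<theta>" and "\<theta> \<le> 1"
  shows "\<exists>Xpart :: real vec set \<Rightarrow> real mat.
    \<forall>S \<in> subspaces_of_dim n k. let r = rank_D n k D S in
      Xpart S \<in> carrier_mat n k \<and> mat_rank (Xpart S) = r \<and>
      (\<exists>P \<in> orthonormal_mats n (k - r). \<exists>W \<in> orthonormal_mats k (k - r).
         bij_betw (\<lambda>Q. Xpart S + P * Q * transpose_mat W)
           (orthonormal_mats (k - r) (k - r)) (maximizers n k A B D \<theta> S) \<and>
         (\<forall>Q \<in> orthonormal_mats (k - r) (k - r).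
            mat_rank (P * Q * transpose_mat W) = k - r))"
  unfolding Let_def
  by (intro bchoice ballI
      maximizers_parametrisation[OF assms(3) assms(5) assms(6) assms(7) assms(8) _ refl])

end
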